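(* Let $X$, $Y$, $(\mathcal{L},\tau)$, $M(X,\mathcal{L})$ and $M_0(X,\mathcal{L})$ be as in the context, and suppose that Assumption (A) stated there holds. If $Z$ is a Banach space and $T:M_0(X,\mathcal{L})\to Z$ is a bounded linear operator, then $T$ is weakly compact if and only if there does not exist a subspace $F\subset M_0(X,\mathcal{L})$ isomorphic to $c_0$ such that $T|_F$ is an isomorphism (onto its image).
   Context: Setting. $X$ and $Y$ are Banach spaces, with $X$ separable and reflexive. $\mathcal{L}\subset B(X,Y)$ is a collection of bounded linear operators $L:X\to Y$, equipped with a topology $\tau$ such that $(\mathcal{L},\tau)$ is Hausdorff, $\sigma$-compact and locally compact, and such that for every $x\in X$ the map $L\mapsto Lx$ is continuous from $(\mathcal{L},\tau)$ to $Y$. The limit $L\to\infty$ means that $L$ escapes all compact subsets of $(\mathcal{L},\tau)$ (equivalently, $L$ tends to $\infty$ in the one-point compactification $\mathcal{L}\cup\{\infty\}$); thus $\varlimsup_{\mathcal{L}\ni L\to\infty}\|Lx\|_Y=\inf_{K}\sup_{L\in\mathcal{L}\setminus K}\|Lx\|_Y$, the infimum being over compact $K\subset\mathcal{L}$, with $\sup\emptyset=0$. Define $$M(X,\mathcal{L})=\{x\in X:\sup_{L\in\mathcal{L}}\|Lx\|_Y<\infty\},\qquad M_0(X,\mathcal{L})=\{x\in M(X,\mathcal{L}):\varlimsup_{\mathcal{L}\ni L\to\infty}\|Lx\|_Y=0\},$$ with norm $\|x\|_M=\sup_{L\in\mathcal{L}}\|Lx\|_Y$ on both. It is assumed that $M(X,\mathcal{L})$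 is dense in $X$ in the $X$-norm, and that $M(X,\mathcal{L})$ is a Banach space under $\|\cdot\|_M$, continuously contained in $X$. Assumption (A). For every $x\in M(X,\mathcal{L})$ there is a bounded sequence $(x_n)_{n=1}^\infty$ in $M_0(X,\mathcal{L})$ such that $x_n$ converges weakly to $x$ in $X$ and $\sup_n\|x_n\|_M\le\|x\|_M$. "Isomorphic"/"isomorphism" means linear homeomorphism (not necessarily isometric). *)

theory Defs
  imports "HOL-Analysis.Analysis"
begin

section \<open>Real or complex scalars\<close>

text \<open>
  The scalar field is either the reals or the complex numbers. The two alternatives of the
  class assumption describe these fields up to isomorphism of normed fields: in the second
  one, \<open>norm (a *\<^sub>R 1 + b *\<^sub>R j) = sqrt (a\<^sup>2 + b\<^sup>2)\<close> is forced by
  the multiplicativity of the norm.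
\<close>

class real_or_complex = real_normed_field +
  assumes real_or_complex:
    "(\<forall>z. \<exists>a. z = a *\<^sub>R 1) \<or>
     (\<exists>j. j * j = - 1 \<and> (\<forall>z. \<exists>a b. z = a *\<^sub>R 1 + b *\<^sub>R j))"

instance real :: real_or_complex
  by standard simp

instance complex :: real_or_complex
proof
  have "\<i> * \<i> = - 1 \<and> (\<forall>z. \<exists>a b. z = a *\<^sub>R 1 + b *\<^sub>R \<i>)"
    by (auto simp: complex_eq_iff)
  then show "(\<forall>z::complex. \<exists>a. z = a *\<^sub>R 1) \<or>
     (\<exists>j::complex. j * j = - 1 \<and> (\<forall>z. \<exists>a b. z = a *\<^sub>R 1 + b *\<^sub>R j))"
    by blast
qed

text \<open>
  A Banach space over the scalars \<open>'k\<close> is a type of class \<^class>\<open>banach\<close> with a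
  scalar multiplication that extends the real one and is compatible with the norm.
\<close>

definition banach_space :: "('k::real_or_complex \<Rightarrow> 'a::banach \<Rightarrow> 'a) \<Rightarrow> bool" where
  "banach_space smul \<longleftrightarrow>
     vector_space smul \<and>
     (\<forall>r x. smul (of_real r) x = r *\<^sub>R x) \<and>
     (\<forall>c x. norm (smul c x) = norm c * norm x)"


section \<open>Dual space, weak topology, reflexivity\<close>

definition dual :: "('k::real_or_complex \<Rightarrow> 'a::banach \<Rightarrow> 'a) \<Rightarrow> ('a \<Rightarrow> 'k) set" where
  "dual smul = {f. Vector_Spaces.linear smul (*) f \<and> bounded_linear f}"

definition weak_topology :: "('k::real_or_complex \<Rightarrow> 'a::banach \<Rightarrow> 'a) \<Rightarrow> 'a topology" where
  "weak_topology smul = topology_generated_by {f -` U | f U. f \<in> dual smul \<and> open U}"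

definition bidual :: "('k::real_or_complex \<Rightarrow> 'a::banach \<Rightarrow> 'a) \<Rightarrow> (('a \<Rightarrow> 'k) \<Rightarrow> 'k) set" where
  "bidual smul = {\<phi>.
     (\<forall>f\<in>dual smul. \<forall>g\<in>dual smul. \<phi> (\<lambda>x. f x + g x) = \<phi> f + \<phi> g) \<and>
     (\<forall>c. \<forall>f\<in>dual smul. \<phi> (\<lambda>x. c * f x) = c * \<phi> f) \<and>
     (\<exists>C. \<forall>f\<in>dual smul. norm (\<phi> f) \<le> C * onorm f)}"

definition reflexive :: "('k::real_or_complex \<Rightarrow> 'a::banach \<Rightarrow> 'a) \<Rightarrow> bool" where
  "reflexive smul \<longleftrightarrow> (\<forall>\<phi>\<in>bidual smul. \<exists>x. \<forall>f\<in>dual smul. \<phi> f = f x)"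


section \<open>Normed subspaces given by a carrier and a norm\<close>

definition linear_on ::
  "('k \<Rightarrow> 'a::plus \<Rightarrow> 'a) \<Rightarrow> ('k \<Rightarrow> 'b::plus \<Rightarrow> 'b) \<Rightarrow> 'a set \<Rightarrow> ('a \<Rightarrow> 'b) \<Rightarrow> bool" where
  "linear_on scaleA scaleB A f \<longleftrightarrow>
     (\<forall>x\<in>A. \<forall>y\<in>A. f (x + y) = f x + f y) \<and>
     (\<forall>c. \<forall>x\<in>A. f (scaleA c x) = scaleB c (f x))"

definition norm_topology :: "'a::minus set \<Rightarrow> ('a \<Rightarrow> real) \<Rightarrow> 'a topology" where
  "norm_topology A N = Metric_space.mtopology A (\<lambda>x y. N (x - y))"

definition banach_space_on ::
  "('k::real_normed_field \<Rightarrow> 'a::ab_group_add \<Rightarrow> 'a) \<Rightarrow> 'a set \<Rightarrow> ('a \<Rightarrow> real) \<Rightarrow> bool" where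
  "banach_space_on smul A N \<longleftrightarrow>
     module.subspace smul A \<and>
     (\<forall>x\<in>A. 0 \<le> N x \<and> (N x = 0 \<longleftrightarrow> x = 0)) \<and>
     (\<forall>x\<in>A. \<forall>y\<in>A. N (x + y) \<le> N x + N y) \<and>
     (\<forall>c. \<forall>x\<in>A. N (smul c x) = norm c * N x) \<and>
     Metric_space.mcomplete A (\<lambda>x y. N (x - y))"

definition linear_homeomorphism_on ::
  "('k \<Rightarrow> 'a::ab_group_add \<Rightarrow> 'a) \<Rightarrow> ('k \<Rightarrow> 'b::ab_group_add \<Rightarrow> 'b) \<Rightarrow>
   'a set \<Rightarrow> ('a \<Rightarrow> real) \<Rightarrow> 'b set \<Rightarrow> ('b \<Rightarrow> real) \<Rightarrow> ('a \<Rightarrow> 'b) \<Rightarrow> bool" where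
  "linear_homeomorphism_on scaleA scaleB A NA B NB f \<longleftrightarrow>
     linear_on scaleA scaleB A f \<and>
     homeomorphic_map (norm_topology A NA) (norm_topology B NB) f"


section \<open>The space $c_0$\<close>

text \<open>Bounded functions on the discrete space \<^typ>\<open>nat\<close> carry the supremum norm.\<close>

definition c0 :: "(nat \<Rightarrow>\<^sub>C 'k::real_or_complex) set" where
  "c0 = {a. apply_bcontfun a \<longlonglongrightarrow> 0}"

definition scale_seq :: "'k::real_or_complex \<Rightarrow> (nat \<Rightarrow>\<^sub>C 'k) \<Rightarrow> (nat \<Rightarrow>\<^sub>C 'k)" where
  "scale_seq c a = Bcontfun (\<lambda>n. c * apply_bcontfun a n)"

lemma apply_scale_seq: "apply_bcontfun (scale_seq c a) n = c * apply_bcontfun a n"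
proof -
  have "bounded ((\<lambda>z. c * z) ` range (apply_bcontfun a))"
    by (intro bounded_linear_image bounded_linear_mult_right bounded_apply_bcontfun)
  then have "(\<lambda>n. c * apply_bcontfun a n) \<in> bcontfun"
    by (simp add: bcontfun_def image_image)
  then show ?thesis
    by (simp add: scale_seq_def Bcontfun_inverse)
qed


section \<open>The spaces $M$ and $M_0$\<close>

text \<open>Suprema are taken in \<^typ>\<open>ennreal\<close>, so the supremum of the empty set is $0$.\<close>

definition sup_norm :: "('x::real_normed_vector \<Rightarrow>\<^sub>L 'y::real_normed_vector) set \<Rightarrow> 'x \<Rightarrow> ennreal" where
  "sup_norm \<L> x = (SUP L\<in>\<L>. ennreal (norm (blinfun_apply L x)))"

definition M_space :: "('x::real_normed_vector \<Rightarrow>\<^sub>L 'y::real_normed_vector) set \<Rightarrow> 'x set" where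
  "M_space \<L> = {x. sup_norm \<L> x < \<infinity>}"

definition M_norm :: "('x::real_normed_vector \<Rightarrow>\<^sub>L 'y::real_normed_vector) set \<Rightarrow> 'x \<Rightarrow> real" where
  "M_norm \<L> x = enn2real (sup_norm \<L> x)"

definition limsup_infinity ::
  "('x::real_normed_vector \<Rightarrow>\<^sub>L 'y::real_normed_vector) set \<Rightarrow> ('x \<Rightarrow>\<^sub>L 'y) topology \<Rightarrow> 'x \<Rightarrow> ennreal" where
  "limsup_infinity \<L> \<tau> x = (INF K\<in>{K. compactin \<tau> K}. sup_norm (\<L> - K) x)"

definition M0_space ::
  "('x::real_normed_vector \<Rightarrow>\<^sub>L 'y::real_normed_vector) set \<Rightarrow> ('x \<Rightarrow>\<^sub>L 'y) topology \<Rightarrow> 'x set" where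
  "M0_space \<L> \<tau> = {x \<in> M_space \<L>. limsup_infinity \<L> \<tau> x = 0}"

definition sigma_compact_space :: "'a topology \<Rightarrow> bool" where
  "sigma_compact_space \<tau> \<longleftrightarrow>
     (\<exists>K :: nat \<Rightarrow> 'a set. (\<forall>n. compactin \<tau> (K n)) \<and> topspace \<tau> = (\<Union>n. K n))"

definition assumption_A ::
  "('k::real_or_complex \<Rightarrow> 'x::banach \<Rightarrow> 'x) \<Rightarrow> ('x \<Rightarrow>\<^sub>L 'y::real_normed_vector) set \<Rightarrow>
   ('x \<Rightarrow>\<^sub>L 'y) topology \<Rightarrow> bool" where
  "assumption_A scaleX \<L> \<tau> \<longleftrightarrow>
     (\<forall>x\<in>M_space \<L>. \<exists>\<xi> :: nat \<Rightarrow> 'x.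
        (\<forall>n. \<xi> n \<in> M0_space \<L> \<tau>) \<and>
        bdd_above (range (\<lambda>n. M_norm \<L> (\<xi> n))) \<and>
        limitin (weak_topology scaleX) \<xi> x sequentially \<and>
        (SUP n. M_norm \<L> (\<xi> n)) \<le> M_norm \<L> x)"


section \<open>Operators on $M_0$\<close>

definition bounded_linear_on ::
  "('k \<Rightarrow> 'a::plus \<Rightarrow> 'a) \<Rightarrow> ('k \<Rightarrow> 'b::real_normed_vector \<Rightarrow> 'b) \<Rightarrow>
   'a set \<Rightarrow> ('a \<Rightarrow> real) \<Rightarrow> ('a \<Rightarrow> 'b) \<Rightarrow> bool" where
  "bounded_linear_on scaleA scaleB A N T \<longleftrightarrow>
     linear_on scaleA scaleB A T \<and> (\<exists>C. \<forall>x\<in>A. norm (T x) \<le> C * N x)"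

definition weakly_compact_on ::
  "('k::real_or_complex \<Rightarrow> 'b::banach \<Rightarrow> 'b) \<Rightarrow> 'a set \<Rightarrow> ('a \<Rightarrow> real) \<Rightarrow> ('a \<Rightarrow> 'b) \<Rightarrow> bool" where
  "weakly_compact_on scaleB A N T \<longleftrightarrow>
     compactin (weak_topology scaleB)
       (weak_topology scaleB closure_of (T ` {x \<in> A. N x \<le> 1}))"

end

theory Submission
  imports Defs
begin

text \<open>
  Suppose that \<open>T\<close> is not weakly compact. The space \<open>X\<close> is reflexive, so the \<open>X\<close>-closure of the
  unit ball of \<open>M\<^sub>0\<close> is weakly compact in \<open>X\<close>. If \<open>T\<close> were continuous at \<open>0\<close> on this ball for the
  norm of \<open>X\<close>, it would extend to the closure as a weak-to-weak continuous map, since every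
  \<open>h \<circ> T\<close> with \<open>h\<close> in the dual of \<open>Z\<close> is then, uniformly on the ball, a limit of functionals on
  \<open>X\<close>; and \<open>T\<close> would be weakly compact. Hence there are \<open>y\<^sub>n\<close> in the unit ball of \<open>M\<^sub>0\<close> with
  \<open>y\<^sub>n \<rightarrow> 0\<close> in \<open>X\<close> and \<open>\<parallel>T y\<^sub>n\<parallel> > e\<close>. On a compact set of operators \<open>y\<^sub>n\<close> is uniformly small for
  large \<open>n\<close>, by uniform boundedness, and each \<open>y\<^sub>n\<close> is small off a compact set. A gliding hump
  therefore makes \<open>\<Sum>n. \<parallel>L y\<^sub>n\<parallel>\<close> bounded uniformly in \<open>L\<close>, so that \<open>a \<mapsto> \<Sum>n. a\<^sub>n y\<^sub>n\<close> maps \<open>c\<^sub>0\<close>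
  boundedly into \<open>M\<^sub>0\<close>. Norming functionals of \<open>T y\<^sub>n\<close> and Rosenthal's disjointification give a
  subsequence on which the composition with \<open>T\<close> is bounded below.
\<close>

section \<open>Functionals over real or complex scalars\<close>

text \<open>\<open>M0\<close> carries two norms. \<open>T\<close> is bounded for the norm of
  \<open>M\<close>, whose unit ball need not be relatively weakly compact; in \<open>X\<close> this
  ball is relatively weakly compact, but \<open>T\<close> need not be continuous for the norm of
  \<open>X\<close>. The proof therefore turns on the behaviour of \<open>T\<close> at
  \<open>0\<close> in the norm of \<open>X\<close>, tested on the ball only. In the continuous case
  this gives no bound by the norm of \<open>X\<close> alone, but only
  \<open>norm (h (T y)) \<le> e * N y + c * norm y\<close> for each \<open>e\<close>; a Hahn-Banach
  argument then splits off a functional on \<open>X\<close> with error \<open>e * N y\<close>. In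
  the discontinuous case smallness in \<open>X\<close> serves twice: it makes the series converge in
  \<open>X\<close>, and it controls the vectors on compact sets of operators. The converse
  implication transports the failure of weak compactness of the ball of \<open>c0\<close> by an
  operator that is bounded below. One class of scalars covers both fields, so real parts are read
  off from the norm by polarization, and Hahn-Banach is proved for real sublinear functionals and
  then complexified.\<close>

lemma real_or_complex_basis:
  obtains j :: "'k::real_or_complex"
  where "j = 0 \<or> j * j = - 1" "\<And>z. \<exists>a b. z = of_real a + of_real b * j"
proof (cases "\<forall>z::'k. \<exists>a. z = a *\<^sub>R 1")
  case True
  then have "\<And>z::'k. \<exists>a b. z = of_real a + of_real b * 0"
    by (simp add: of_real_def)
  then show ?thesis using that[of 0] by blast
next
  case False
  then obtain j :: 'k where "j * j = - 1" "\<forall>z. \<exists>a b. z = a *\<^sub>R 1 + b *\<^sub>R j"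
    using real_or_complex by blast
  moreover from this have "\<And>z::'k. \<exists>a b. z = of_real a + of_real b * j"
    by (simp add: of_real_def)
  ultimately show ?thesis using that[of j] by blast
qed

text \<open>All powers of such an element again have coordinates on the unit circle, and
  \<open>norm j = 1\<close>, so their norms are at most 2. By multiplicativity a norm above 1 would
  make them unbounded.\<close>

lemma norm_basis_le_one:
  fixes j :: "'k::real_normed_field"
  assumes j: "j * j = - 1" and ab: "a\<^sup>2 + b\<^sup>2 = (1::real)"
  shows "norm (of_real a + of_real b * j) \<le> 1"
proof (rule ccontr)
  let ?u = "of_real a + of_real b * j"
  assume "\<not> norm ?u \<le> 1"
  then obtain n where n: "2 < norm ?u ^ n"
    using real_arch_pow[of "norm ?u" 2] by auto
  have pow: "\<exists>c d. ?u ^ m = of_real c + of_real d * j \<and> c\<^sup>2 + d\<^sup>2 = 1" for m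
  proof (induction m)
    case 0
    show ?case by (rule exI[of _ 1], rule exI[of _ 0]) simp
  next
    case (Suc m)
    then obtain c d where cd: "?u ^ m = of_real c + of_real d * j" "c\<^sup>2 + d\<^sup>2 = 1" by blast
    have "?u ^ Suc m = of_real a * of_real c + (of_real b * of_real d) * (j * j)
        + (of_real a * of_real d + of_real b * of_real c) * j"
      using cd(1) by (simp add: algebra_simps)
    then have "?u ^ Suc m = of_real (a * c - b * d) + of_real (a * d + b * c) * j"
      by (simp add: j)
    moreover have "(a * c - b * d)\<^sup>2 + (a * d + b * c)\<^sup>2 = (a\<^sup>2 + b\<^sup>2) * (c\<^sup>2 + d\<^sup>2)"
      by (simp add: power2_eq_square algebra_simps)
    ultimately show ?case using ab cd(2) by (metis mult_1)
  qed
  obtain c d where cd: "?u ^ n = of_real c + of_real d * j" "c\<^sup>2 + d\<^sup>2 = 1"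
    using pow by blast
  have "norm j * norm j = 1" by (metis j norm_minus_cancel norm_mult norm_one)
  then have nj: "norm j = 1"
    by (metis abs_norm_cancel abs_square_eq_1 power2_eq_square)
  have c1: "\<bar>c\<bar> \<le> 1" and d1: "\<bar>d\<bar> \<le> 1"
    using cd(2) by (metis abs_square_le_1 le_add_same_cancel1 zero_le_power2 add.commute)+
  have "norm (?u ^ n) \<le> \<bar>c\<bar> + \<bar>d\<bar>"
    using norm_triangle_ineq[of "of_real c" "of_real d * j"] by (simp add: cd(1) norm_mult nj)
  then show False using n c1 d1 by (simp add: norm_power)
qed

text \<open>The product with the conjugate \<open>of_real a + of_real (- b) * j\<close> is
  \<open>r\<^sup>2\<close>, and both factors have norm at most \<open>r\<close>, so neither can be
  smaller.\<close>

lemma norm_basis: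
  fixes j :: "'k::real_normed_field"
  assumes j: "j * j = - 1"
  shows "(norm (of_real a + of_real b * j))\<^sup>2 = a\<^sup>2 + b\<^sup>2"
proof (cases "a = 0 \<and> b = 0")
  case False
  define r where "r = sqrt (a\<^sup>2 + b\<^sup>2)"
  have r: "r > 0" "r\<^sup>2 = a\<^sup>2 + b\<^sup>2"
    using False by (auto simp: r_def sum_power2_gt_zero_iff)
  have le: "norm (of_real a + of_real b' * j) \<le> r" if "b'\<^sup>2 = b\<^sup>2" for b'
  proof -
    have "(a / r)\<^sup>2 + (b' / r)\<^sup>2 = 1"
      using r(1) by (simp add: power_divide that r(2)[symmetric] add_divide_distrib[symmetric])
    then have "norm (of_real (a / r) + of_real (b' / r) * j) \<le> 1"
      by (rule norm_basis_le_one[OF j])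
    moreover have "of_real a + of_real b' * j = of_real r * (of_real (a / r) + of_real (b' / r) * j)"
      using r by (simp add: field_simps)
    ultimately show ?thesis
      using r by (simp add: norm_mult mult_left_le)
  qed
  have "(of_real a + of_real b * j) * (of_real a + of_real (- b) * j)
      = of_real a * of_real a - (of_real b * of_real b) * (j * j)"
    by (simp add: algebra_simps)
  also have "\<dots> = of_real (a\<^sup>2 + b\<^sup>2)" by (simp add: j power2_eq_square)
  also have "\<dots> = of_real (r\<^sup>2)" by (simp only: r(2))
  finally have "norm (of_real a + of_real b * j) * norm (of_real a + of_real (- b) * j) = r\<^sup>2"
    by (metis norm_mult norm_of_real abs_power2)
  then have "r * r \<le> norm (of_real a + of_real b * j) * r"
    using mult_left_mono[OF le[of "- b"], of "norm (of_real a + of_real b * j)"]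
    by (simp add: power2_eq_square)
  then have "norm (of_real a + of_real b * j) = r"
    using le[of b] r(1) by simp
  then show ?thesis using r by simp
qed simp

text \<open>Polarization between \<open>1\<close> and \<open>z\<close>: only the norm enters, so no
  choice of \<open>j\<close> is built into the definition.\<close>

definition real_part :: "'k::real_normed_field \<Rightarrow> real" where
  "real_part z = ((norm (1 + z))\<^sup>2 - (norm (1 - z))\<^sup>2) / 4"

lemma real_part_of_real [simp]: "real_part (of_real a) = a"
proof -
  have "norm (1 + of_real a :: 'a) = \<bar>1 + a\<bar>" "norm (1 - of_real a :: 'a) = \<bar>1 - a\<bar>"
    by (metis norm_of_real of_real_1 of_real_add, metis norm_of_real of_real_1 of_real_diff)
  then show ?thesis by (simp add: real_part_def power2_eq_square algebra_simps)
qed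

lemma real_part_basis:
  fixes j :: "'k::real_normed_field"
  assumes "j = 0 \<or> j * j = - 1"
  shows "real_part (of_real a + of_real b * j) = a"
proof (cases "j = 0")
  case False
  then have j: "j * j = - 1" using assms by blast
  have e1: "1 + (of_real a + of_real b * j) = of_real (1 + a) + of_real b * j"
    and e2: "1 - (of_real a + of_real b * j) = of_real (1 - a) + of_real (- b) * j"
    by simp_all
  have "(norm (1 + (of_real a + of_real b * j)))\<^sup>2 = (1 + a)\<^sup>2 + b\<^sup>2"
    and "(norm (1 - (of_real a + of_real b * j)))\<^sup>2 = (1 - a)\<^sup>2 + b\<^sup>2"
    unfolding e1 e2 norm_basis[OF j] by simp_all
  then show ?thesis by (simp add: real_part_def power2_eq_square algebra_simps)
qed simp

lemma real_part_add: "real_part (z + w) = real_part z + real_part (w::'k::real_or_complex)"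
proof -
  obtain j :: 'k where j: "j = 0 \<or> j * j = - 1" "\<And>z. \<exists>a b. z = of_real a + of_real b * j"
    by (rule real_or_complex_basis) blast
  obtain a b where z: "z = of_real a + of_real b * j" using j(2) by blast
  obtain c d where w: "w = of_real c + of_real d * j" using j(2) by blast
  have "z + w = of_real (a + c) + of_real (b + d) * j" by (simp add: z w algebra_simps)
  then show ?thesis using real_part_basis[OF j(1)] z w by metis
qed

lemma real_part_of_real_mult:
  "real_part (of_real r * z) = r * real_part (z::'k::real_or_complex)"
proof -
  obtain j :: 'k where j: "j = 0 \<or> j * j = - 1" "\<And>z. \<exists>a b. z = of_real a + of_real b * j"
    by (rule real_or_complex_basis) blast
  obtain a b where z: "z = of_real a + of_real b * j" using j(2) by blast
  have "of_real r * z = of_real (r * a) + of_real (r * b) * j" by (simp add: z algebra_simps)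
  then show ?thesis using real_part_basis[OF j(1)] z by metis
qed

lemma abs_real_part_le: "\<bar>real_part z\<bar> \<le> norm (z::'k::real_or_complex)"
proof -
  obtain j :: 'k where j: "j = 0 \<or> j * j = - 1" "\<And>z. \<exists>a b. z = of_real a + of_real b * j"
    by (rule real_or_complex_basis) blast
  obtain a b where z: "z = of_real a + of_real b * j" using j(2) by blast
  show ?thesis
  proof (cases "j = 0")
    case False
    then have "(norm z)\<^sup>2 = a\<^sup>2 + b\<^sup>2" using norm_basis j(1) z by blast
    then have "\<bar>a\<bar>\<^sup>2 \<le> (norm z)\<^sup>2" by simp
    then have "\<bar>a\<bar> \<le> norm z" by (rule power2_le_imp_le) simp
    then show ?thesis using real_part_basis[OF j(1)] z by metis
  qed (simp add: z)
qed

lemma real_part_le: "real_part z \<le> norm (z::'k::real_or_complex)"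
  using abs_real_part_le[of z] by linarith

text \<open>For real scalars \<open>j = 0\<close>; this lets a single formula complexify real functionals.\<close>

lemma real_part_decomposition:
  obtains j :: "'k::real_or_complex"
  where "j = 0 \<or> j * j = - 1" "real_part j = 0"
    "\<And>z. z = of_real (real_part z) - j * of_real (real_part (j * z))"
proof -
  obtain j :: 'k where j: "j = 0 \<or> j * j = - 1" "\<And>z. \<exists>a b. z = of_real a + of_real b * j"
    by (rule real_or_complex_basis) blast
  have "z = of_real (real_part z) - j * of_real (real_part (j * z))" for z
  proof -
    obtain a b where z: "z = of_real a + of_real b * j" using j(2) by blast
    then have a: "real_part z = a" using real_part_basis[OF j(1)] by blast
    show ?thesis
    proof (cases "j = 0")
      case False
      then have jj: "j * j = - 1" using j(1) by blast
      have "j * z = of_real a * j + of_real b * (j * j)" by (simp add: z algebra_simps)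
      then have "j * z = of_real (- b) + of_real a * j" by (simp add: jj)
      then have "real_part (j * z) = - b" using real_part_basis[OF j(1)] by metis
      then show ?thesis using a z by simp
    qed (use a z in simp)
  qed
  moreover have "real_part j = 0" using real_part_basis[OF j(1), of 0 1] by simp
  ultimately show ?thesis using j(1) that by blast
qed

text \<open>Rotating by \<open>c\<close> makes a value real and nonnegative. This turns a bound on
  real parts over a set closed under scalars into a bound on norms.\<close>

lemma phase_exists:
  fixes w :: "'k::real_normed_field"
  obtains c where "norm c = 1" "c * w = of_real (norm w)"
proof (cases "w = 0")
  case False
  then show ?thesis
    using that[of "of_real (norm w) / w"] by (simp add: norm_divide)
qed (use that[of 1] in simp)

text \<open>Real coordinates exhibit the ball as a closed part of a continuous image of a square.
  Its compactness feeds Tychonoff's theorem in the proof of weak compactness.\<close>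

lemma compact_cball_scalar: "compact (cball 0 r :: 'k::real_or_complex set)"
proof -
  obtain j :: 'k where j: "j = 0 \<or> j * j = - 1" "real_part j = 0"
    "\<And>z. z = of_real (real_part z) - j * of_real (real_part (j * z))"
    by (rule real_part_decomposition) blast
  let ?f = "\<lambda>p::real \<times> real. of_real (fst p) - j * of_real (snd p)"
  have "norm j \<le> 1"
  proof (cases "j = 0")
    case False
    then have "norm j * norm j = 1" using j(1) by (metis norm_minus_cancel norm_mult norm_one)
    then show ?thesis by (metis abs_norm_cancel abs_square_eq_1 power2_eq_square order_refl)
  qed simp
  then have jz: "norm (j * z) \<le> norm z" for z
    by (simp add: norm_mult mult_left_le_one_le)
  have comp: "compact (?f ` ({-r..r} \<times> {-r..r}))"
    by (intro compact_continuous_image compact_Times compact_Icc continuous_intros)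
  have "cball 0 r \<subseteq> ?f ` ({-r..r} \<times> {-r..r})"
  proof
    fix z :: 'k assume "z \<in> cball 0 r"
    then have "norm z \<le> r" by simp
    then have "\<bar>real_part z\<bar> \<le> r" "\<bar>real_part (j * z)\<bar> \<le> r"
      using abs_real_part_le[of z] abs_real_part_le[of "j * z"] jz[of z] by linarith+
    then have "(real_part z, real_part (j * z)) \<in> {-r..r} \<times> {-r..r}" by auto
    moreover have "z = ?f (real_part z, real_part (j * z))"
      unfolding fst_conv snd_conv by (rule j(3))
    ultimately show "z \<in> ?f ` ({-r..r} \<times> {-r..r})" by (rule image_eqI[rotated])
  qed
  then have "?f ` ({-r..r} \<times> {-r..r}) \<inter> cball 0 r = cball 0 r" by (rule inf.absorb2)
  with compact_Int_closed[OF comp closed_cball, of 0 r] show ?thesis by (simp only:)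
qed

section \<open>The Hahn-Banach theorem\<close>

lemma subspace_Union_chain:
  assumes "C \<noteq> {}" "\<And>G. G \<in> C \<Longrightarrow> subspace G"
    and chain: "\<And>G H. G \<in> C \<Longrightarrow> H \<in> C \<Longrightarrow> G \<subseteq> H \<or> H \<subseteq> G"
  shows "subspace (\<Union>C)"
proof (rule subspaceI)
  show "0 \<in> \<Union>C" using assms subspace_0 by blast
  show "x + y \<in> \<Union>C" if xy: "x \<in> \<Union>C" "y \<in> \<Union>C" for x y
  proof -
    obtain G H where GH: "G \<in> C" "x \<in> G" "H \<in> C" "y \<in> H" using xy by blast
    then show ?thesis using chain[of G H] assms(2) subspace_add by blast
  qed
  show "c *\<^sub>R x \<in> \<Union>C" if "x \<in> \<Union>C" for c x
    using that assms(2) subspace_scale by blast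
qed

text \<open>Functionals below \<open>P\<close> are represented by their graphs; Zorn's lemma gives a maximal graph.\<close>

theorem hahn_banach_real:
  fixes P :: "'a::real_vector \<Rightarrow> real"
  assumes add: "\<And>x y. P (x + y) \<le> P x + P y"
    and hom: "\<And>r x. 0 \<le> r \<Longrightarrow> P (r *\<^sub>R x) = r * P x"
  obtains u where "linear u" "\<And>x. u x \<le> P x" "u x0 = P x0"
proof -
  have P0: "P 0 = 0" using hom[of 0 0] by simp
  \<comment> \<open>Single-valuedness is not demanded of the graphs: domination by \<open>P\<close>
    and \<open>P 0 = 0\<close> force it. Containing \<open>(x0, P x0)\<close> is what gives
    \<open>u x0 = P x0\<close>.\<close>
  define \<A> where "\<A> = {G :: ('a \<times> real) set. subspace G \<and> (\<forall>(x,t)\<in>G. t \<le> P x) \<and> (x0, P x0) \<in> G}"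
  have "span {(x0, P x0)} \<in> \<A>"
  proof -
    have "k * P x0 \<le> P (k *\<^sub>R x0)" for k
    proof (cases "0 \<le> k")
      case False
      have "0 \<le> P (k *\<^sub>R x0) + P ((- k) *\<^sub>R x0)"
        using add[of "k *\<^sub>R x0" "(- k) *\<^sub>R x0"] P0 by simp
      then show ?thesis using hom[of "- k" x0] False by simp
    qed (simp add: hom)
    then have "\<forall>(x, t) \<in> span {(x0, P x0)}. t \<le> P x" by (auto simp: span_singleton)
    then show ?thesis
      by (simp add: \<A>_def span_base)
  qed
  then have ne: "\<A> \<noteq> {}" by blast
  have "\<exists>M\<in>\<A>. \<forall>X\<in>\<A>. M \<subseteq> X \<longrightarrow> X = M"
  proof (rule subset_Zorn_nonempty[OF ne])
    fix C assume C: "C \<noteq> {}" "subset.chain \<A> C"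
    then have CA: "C \<subseteq> \<A>" and ch: "\<And>G H. G \<in> C \<Longrightarrow> H \<in> C \<Longrightarrow> G \<subseteq> H \<or> H \<subseteq> G"
      by (auto simp: subset_chain_def)
    have "subspace (\<Union>C)"
      by (rule subspace_Union_chain[OF C(1) _ ch]) (use CA in \<open>auto simp: \<A>_def\<close>)
    then show "\<Union>C \<in> \<A>" using C(1) CA by (fastforce simp: \<A>_def)
  qed
  then obtain G where G: "G \<in> \<A>" and max: "\<And>H. H \<in> \<A> \<Longrightarrow> G \<subseteq> H \<Longrightarrow> H = G" by blast
  have sG: "subspace G" and leG: "\<And>x t. (x,t) \<in> G \<Longrightarrow> t \<le> P x" and x0G: "(x0, P x0) \<in> G"
    using G by (auto simp: \<A>_def)
  have uniq: "s = t" if "(x,s) \<in> G" "(x,t) \<in> G" for x s t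
  proof -
    have "(0, s - t) \<in> G" "(0, t - s) \<in> G"
      using subspace_diff[OF sG that] subspace_diff[OF sG that(2) that(1)] by simp_all
    then show ?thesis using leG[of 0 "s - t"] leG[of 0 "t - s"] P0 by simp
  qed
  have tot: "\<exists>t. (x,t) \<in> G" for x
  proof -
    \<comment> \<open>An admissible value at \<open>x\<close> lies above all
      \<open>s - P (v - x)\<close> and below all \<open>P (w + x) - t\<close>. Subadditivity puts
      every lower bound below every upper one, so the supremum of the lower bounds works.\<close>
    define lower where "lower = (\<lambda>(v, s). s - P (v - x)) ` G"
    have cross: "s - P (v - x) \<le> P (w + x) - t" if "(v,s) \<in> G" "(w,t) \<in> G" for v s w t
    proof -
      have "s + t \<le> P (v + w)" using leG subspace_add[OF sG that] by simp
      also have "\<dots> \<le> P (v - x) + P (w + x)" using add[of "v - x" "w + x"] by (simp add: algebra_simps)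
      finally show ?thesis by simp
    qed
    have G0: "(0,0) \<in> G" using subspace_0[OF sG] by (simp add: zero_prod_def)
    have bdd: "bdd_above lower"
      unfolding lower_def bdd_above_def using cross[OF _ G0] by (intro exI[of _ "P (0 + x) - 0"]) auto
    define a where "a = Sup lower"
    have a1: "s - P (v - x) \<le> a" if "(v,s) \<in> G" for v s
      unfolding a_def by (rule cSup_upper[OF _ bdd]) (use that in \<open>force simp: lower_def\<close>)
    have a2: "a \<le> P (w + x) - t" if "(w,t) \<in> G" for w t
      unfolding a_def by (rule cSup_least) (use that G0 cross in \<open>auto simp: lower_def\<close>)
    define H where "H = span (insert (x,a) G)"
    have "t \<le> P v" if "(v,t) \<in> H" for v t
    proof -
      obtain k where "(v,t) - k *\<^sub>R (x,a) \<in> span G"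
        using \<open>(v,t) \<in> H\<close> unfolding H_def span_breakdown_eq by blast
      moreover have "span G = G" using sG by (simp add: span_eq_iff)
      ultimately have k: "(v - k *\<^sub>R x, t - k * a) \<in> G" by simp
      show ?thesis
      proof (cases "k = 0")
        case False
        \<comment> \<open>Scaling by \<open>m\<close> turns the coefficient of \<open>x\<close> into
          \<open>1\<close> or \<open>- 1\<close>, the cases covered by \<open>a2\<close> and
          \<open>a1\<close>.\<close>
        define m where "m = inverse \<bar>k\<bar>"
        have m: "m > 0" "m * \<bar>k\<bar> = 1" using False by (auto simp: m_def)
        have mk: "(m *\<^sub>R v - (m * k) *\<^sub>R x, m * t - m * k * a) \<in> G"
          using subspace_scale[OF sG k, of m] by (simp add: algebra_simps)
        have "m * t \<le> P (m *\<^sub>R v)"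
        proof (cases "k > 0")
          case True
          then have "m * k = 1" using m by simp
          then show ?thesis using a2[OF mk] by (simp add: algebra_simps)
        next
          case kn: False
          then have "m * k = - 1" using m by simp
          then show ?thesis using a1[OF mk] by (simp add: algebra_simps)
        qed
        then show ?thesis using m hom[of m v] by simp
      qed (use k leG in auto)
    qed
    then have "H \<in> \<A>"
      using x0G by (auto simp: \<A>_def H_def span_base)
    moreover have "G \<subseteq> H" by (auto simp: H_def span_base)
    ultimately have "H = G" by (rule max)
    then show ?thesis unfolding H_def by (metis insertI1 span_base)
  qed
  define u where "u x = (THE t. (x,t) \<in> G)" for x
  have uG: "(x, u x) \<in> G" for x
    unfolding u_def by (rule theI') (use tot uniq in blast)
  have "linear u"
  proof (rule linearI)
    show "u (x + y) = u x + u y" for x y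
      using subspace_add[OF sG uG[of x] uG[of y]] uG[of "x + y"] uniq by simp
    show "u (r *\<^sub>R x) = r *\<^sub>R u x" for r x
      using subspace_scale[OF sG uG[of x], of r] uG[of "r *\<^sub>R x"] uniq by simp
  qed
  then show ?thesis using that leG[OF uG] uniq[OF uG x0G] by blast
qed

section \<open>Banach spaces over the scalars and their duals\<close>

lemma banach_spaceD:
  assumes "banach_space smul"
  shows "vector_space smul" "module smul"
    "smul (of_real r) x = r *\<^sub>R x" "norm (smul c x) = norm c * norm x"
  using assms by (auto simp: banach_space_def vector_space_def module_def)

lemma dualD:
  assumes "f \<in> dual smul"
  shows "f (x + y) = f x + f y" "f (smul c x) = c * f x" "f (x - y) = f x - f y" "f 0 = 0"
    "continuous_on S f" "bounded_linear f"
proof -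
  have bl: "bounded_linear f" and l: "Vector_Spaces.linear smul (*) f"
    using assms by (auto simp: dual_def)
  show "bounded_linear f" by (rule bl)
  show "f (x + y) = f x + f y" "f (x - y) = f x - f y" "f 0 = 0"
    using bl by (simp_all add: linear_simps)
  show "f (smul c x) = c * f x" using l by (simp add: Vector_Spaces.linear_iff)
  show "continuous_on S f" by (simp add: bl linear_continuous_on)
qed

lemma dualI:
  assumes smul: "banach_space smul"
    and "\<And>x y. f (x + y) = f x + f y" "\<And>c x. f (smul c x) = c * f x"
    and "\<And>x. norm (f x) \<le> C * norm x"
  shows "f \<in> dual smul"
proof -
  have "vector_space ((*) :: 'a \<Rightarrow> 'a \<Rightarrow> 'a)"
    by unfold_locales (auto simp: algebra_simps)
  then have "Vector_Spaces.linear smul (*) f"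
    using assms banach_spaceD(1)[OF smul] by (simp add: Vector_Spaces.linear_iff)
  moreover have "bounded_linear f"
  proof (rule bounded_linear_intro[where K = C])
    show "f (r *\<^sub>R x) = r *\<^sub>R f x" for r x
      using assms(3)[of "of_real r" x] by (simp add: banach_spaceD(3)[OF smul] scaleR_conv_of_real)
    show "norm (f x) \<le> norm x * C" for x using assms(4)[of x] by (simp add: mult.commute)
  qed (rule assms)
  ultimately show ?thesis by (simp add: dual_def)
qed

text \<open>The sublinear functional used is the infimal convolution of \<open>\<phi>\<close> and \<open>c\<close> times the norm.\<close>

lemma hahn_banach_inf_convolution:
  fixes smul :: "'k::real_or_complex \<Rightarrow> 'a::banach \<Rightarrow> 'a"
  assumes smul: "banach_space smul" and A: "module.subspace smul A" and c: "0 \<le> c"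
    and add: "\<And>x y. x \<in> A \<Longrightarrow> y \<in> A \<Longrightarrow> \<phi> (x + y) \<le> \<phi> x + \<phi> y"
    and hom: "\<And>r x. 0 \<le> r \<Longrightarrow> x \<in> A \<Longrightarrow> \<phi> (r *\<^sub>R x) = r * \<phi> x"
    and low: "\<And>x. x \<in> A \<Longrightarrow> - (c * norm x) \<le> \<phi> x"
    and t: "\<And>y. y \<in> A \<Longrightarrow> t \<le> \<phi> y + c * norm (x0 - y)"
  obtains f where "f \<in> dual smul" "\<And>x. norm (f x) \<le> c * norm x"
    "\<And>y. y \<in> A \<Longrightarrow> real_part (f y) \<le> \<phi> y" "t \<le> real_part (f x0)"
proof -
  note [simp] = banach_spaceD(3)[OF smul]
  note md = banach_spaceD(2)[OF smul]
  have A0: "0 \<in> A" and Aadd: "\<And>x y. x \<in> A \<Longrightarrow> y \<in> A \<Longrightarrow> x + y \<in> A"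
    and Ascale: "\<And>r x. x \<in> A \<Longrightarrow> r *\<^sub>R x \<in> A"
    using module.subspace_0[OF md A] module.subspace_add[OF md A]
      module.subspace_scale[OF md A, of _ "of_real _"] by auto
  have \<phi>0: "\<phi> 0 = 0" using hom[of 0 0] A0 by simp
  \<comment> \<open>Taking \<open>y = x\<close> gives \<open>P \<le> \<phi>\<close> on
    \<open>A\<close>, and \<open>y = 0\<close> gives \<open>P x \<le> c * norm x\<close> everywhere,
    so domination by \<open>P\<close> yields both estimates at once. The hypothesis
    \<open>low\<close> keeps the infimum finite, and \<open>t\<close> bounds \<open>P x0\<close>
    from below.\<close>
  define P where "P x = (INF y\<in>A. \<phi> y + c * norm (x - y))" for x
  have lower: "- (c * norm x) \<le> \<phi> y + c * norm (x - y)" if "y \<in> A" for x y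
  proof -
    have "c * norm y \<le> c * (norm x + norm (x - y))"
      using c by (intro mult_left_mono) (metis norm_triangle_sub norm_minus_commute)
    then show ?thesis using low[OF that] by (simp add: algebra_simps)
  qed
  then have bdd: "bdd_below ((\<lambda>y. \<phi> y + c * norm (x - y)) ` A)" for x
    by (auto simp: bdd_below_def)
  have PI: "P x \<le> \<phi> y + c * norm (x - y)" if "y \<in> A" for x y
    unfolding P_def using bdd that by (rule cINF_lower)
  have PG: "m \<le> P x" if "\<And>y. y \<in> A \<Longrightarrow> m \<le> \<phi> y + c * norm (x - y)" for m x
    unfolding P_def using A0 that by (intro cINF_greatest) auto
  have Padd: "P (x + x') \<le> P x + P x'" for x x'
  proof -
    have "P (x + x') \<le> (\<phi> y + c * norm (x - y)) + (\<phi> y' + c * norm (x' - y'))"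
      if "y \<in> A" "y' \<in> A" for y y'
    proof -
      have "c * norm ((x + x') - (y + y')) \<le> c * (norm (x - y) + norm (x' - y'))"
        using c by (intro mult_left_mono) (simp add: norm_diff_triangle_ineq)
      then show ?thesis
        using PI[OF Aadd[OF that], of "x + x'"] add[OF that] by (simp add: algebra_simps)
    qed
    then have "P (x + x') - (\<phi> y' + c * norm (x' - y')) \<le> P x" if "y' \<in> A" for y'
      using that by (intro PG) (simp add: algebra_simps)
    then have "P (x + x') - P x \<le> P x'" by (intro PG) (simp add: algebra_simps)
    then show ?thesis by simp
  qed
  have P0: "P 0 = 0"
    using PI[OF A0, of 0] PG[of 0 0] low by (fastforce intro!: antisym simp: \<phi>0)
  \<comment> \<open>One inequality suffices: applied to \<open>inverse r\<close> it gives the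
    reverse one.\<close>
  have Ple: "P (r *\<^sub>R x) \<le> r * P x" if r: "r > 0" for r x
  proof -
    have "inverse r * P (r *\<^sub>R x) \<le> P x"
    proof (rule PG)
      fix y assume y: "y \<in> A"
      have "P (r *\<^sub>R x) \<le> \<phi> (r *\<^sub>R y) + c * norm (r *\<^sub>R x - r *\<^sub>R y)"
        by (rule PI[OF Ascale[OF y]])
      also have "norm (r *\<^sub>R x - r *\<^sub>R y) = r * norm (x - y)"
        using r by (metis abs_of_pos norm_scaleR scaleR_diff_right)
      also have "\<phi> (r *\<^sub>R y) + c * (r * norm (x - y)) = r * (\<phi> y + c * norm (x - y))"
        using r y by (simp add: hom algebra_simps)
      finally show "inverse r * P (r *\<^sub>R x) \<le> \<phi> y + c * norm (x - y)"
        using r by (simp add: field_simps)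
    qed
    then show ?thesis using r by (simp add: field_simps)
  qed
  have Phom: "P (r *\<^sub>R x) = r * P x" if "0 \<le> r" for r x
  proof (cases "r = 0")
    case False
    then have r: "r > 0" using that by simp
    have "P (inverse r *\<^sub>R (r *\<^sub>R x)) \<le> inverse r * P (r *\<^sub>R x)"
      using Ple[of "inverse r" "r *\<^sub>R x"] r by simp
    then have "r * P x \<le> P (r *\<^sub>R x)" using r by (simp add: field_simps)
    then show ?thesis using Ple[OF r] by (metis antisym)
  qed (simp add: P0)
  obtain u where u: "linear u" "\<And>x. u x \<le> P x" "u x0 = P x0"
    using hahn_banach_real[of P x0] Padd Phom by metis
  obtain j :: 'k where j: "j = 0 \<or> j * j = - 1" "real_part j = 0"
    "\<And>z. z = of_real (real_part z) - j * of_real (real_part (j * z))"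
    by (rule real_part_decomposition) blast
  \<comment> \<open>\<open>u\<close> is only real-linear. This \<open>f\<close> has real part
    \<open>u\<close> and commutes with \<open>j\<close>, hence with all scalars.\<close>
  define f where "f x = of_real (u x) - j * of_real (u (smul j x))" for x
  have uadd: "u (x + y) = u x + u y" and uscale: "u (r *\<^sub>R x) = r * u x" for x y r
    using u(1) by (simp_all add: linear_add linear_scale)
  have sadd: "smul a (x + y) = smul a x + smul a y" and sadd': "smul (a + b) x = smul a x + smul b x"
    and sm: "smul a (smul b x) = smul (a * b) x" for a b x y
    using md by (simp_all add: module_def)
  have fre: "real_part (f x) = u x" for x
  proof -
    have "real_part (f x) = real_part (of_real (u x) + of_real (- u (smul j x)) * j)"
      by (simp add: f_def mult.commute)
    also have "\<dots> = u x" by (simp only: real_part_add real_part_of_real real_part_of_real_mult j)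
    finally show ?thesis .
  qed
  have fadd: "f (x + y) = f x + f y" for x y
    by (simp add: f_def sadd uadd algebra_simps)
  have freal: "f (r *\<^sub>R x) = of_real r * f x" for r x
  proof -
    have "smul j (r *\<^sub>R x) = r *\<^sub>R smul j x"
      using sm[of j "of_real r" x] sm[of "of_real r" j x] by (simp add: mult.commute)
    then show ?thesis by (simp add: f_def uscale algebra_simps)
  qed
  have fj: "f (smul j x) = j * f x" for x
  proof (cases "j = 0")
    case True
    then have "smul j x = 0" using md module.scale_zero_left by blast
    then show ?thesis using True freal[of 0 0] by simp
  next
    case False
    then have jj: "j * j = - 1" using j(1) by blast
    have "smul j (smul j x) = (-1) *\<^sub>R x"
      using sm[of j j x] banach_spaceD(3)[OF smul, of "-1" x] by (simp add: jj)
    then have "u (smul j (smul j x)) = - u x" using uscale[of "-1" x] by simp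
    moreover have "j * (j * w) = - w" for w by (metis jj mult.assoc mult_minus1)
    ultimately show ?thesis
      by (simp add: f_def right_diff_distrib)
  qed
  have fscale: "f (smul z x) = z * f x" for z x
  proof -
    define a b where "a = real_part z" and "b = - real_part (j * z)"
    have "of_real (real_part z) - j * of_real (real_part (j * z)) = of_real a + of_real b * j"
      by (simp add: a_def b_def mult.commute)
    with j(3)[of z] have z: "z = of_real a + of_real b * j" by (rule trans)
    have "smul z x = a *\<^sub>R x + b *\<^sub>R smul j x" by (simp add: z sadd' sm[symmetric])
    then show ?thesis by (simp add: fadd freal fj z algebra_simps)
  qed
  have bound: "norm (f x) \<le> c * norm x" for x
  proof -
    obtain w where w: "norm w = 1" "w * f x = of_real (norm (f x))" by (rule phase_exists)
    have "norm (f x) = real_part (f (smul w x))" by (simp add: fscale w)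
    also have "\<dots> \<le> P (smul w x)" by (simp add: fre u)
    also have "\<dots> \<le> c * norm (smul w x)" using PI[OF A0, of "smul w x"] by (simp add: \<phi>0)
    also have "\<dots> = c * norm x" by (simp add: banach_spaceD(4)[OF smul] w)
    finally show ?thesis .
  qed
  have "f \<in> dual smul" by (rule dualI[OF smul fadd fscale bound])
  moreover have "real_part (f y) \<le> \<phi> y" if "y \<in> A" for y
    using u(2)[of y] PI[OF that, of y] by (simp add: fre)
  moreover have "t \<le> real_part (f x0)" using PG[of t x0] t by (simp add: fre u)
  ultimately show ?thesis using that bound by blast
qed

section \<open>Weak compactness in reflexive spaces\<close>

lemma zero_in_dual: "banach_space smul \<Longrightarrow> (\<lambda>x. 0) \<in> dual smul"
  by (rule dualI[where C = 0]) auto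

lemma add_in_dual:
  assumes smul: "banach_space smul" and "f \<in> dual smul" "g \<in> dual smul"
  shows "(\<lambda>x. f x + g x) \<in> dual smul"
proof (rule dualI[OF smul])
  show "norm (f x + g x) \<le> (onorm f + onorm g) * norm x" for x
    using norm_triangle_ineq[of "f x" "g x"] onorm[OF dualD(6)[OF assms(2)], of x]
      onorm[OF dualD(6)[OF assms(3)], of x]
    by (simp add: algebra_simps)
qed (simp_all add: dualD(1,2)[OF assms(2)] dualD(1,2)[OF assms(3)] algebra_simps)

lemma scale_in_dual:
  assumes smul: "banach_space smul" and "f \<in> dual smul"
  shows "(\<lambda>x. c * f x) \<in> dual smul"
proof (rule dualI[OF smul])
  show "norm (c * f x) \<le> (norm c * onorm f) * norm x" for x
    using onorm[OF dualD(6)[OF assms(2)], of x] by (simp add: norm_mult mult_left_mono mult.assoc)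
qed (simp_all add: dualD(1,2)[OF assms(2)] algebra_simps)

section \<open>The weak topology and separation by functionals\<close>

lemma topspace_weak_topology [simp]:
  assumes "banach_space smul" shows "topspace (weak_topology smul) = UNIV"
proof -
  have "UNIV \<in> {f -` U | f U. f \<in> dual smul \<and> open U}"
    by (rule CollectI, rule exI[of _ "\<lambda>x. 0"], rule exI[of _ UNIV])
      (simp add: zero_in_dual[OF assms])
  then show ?thesis
    unfolding weak_topology_def topology_generated_by_topspace by blast
qed

lemma openin_weak_topology_vimage:
  "f \<in> dual smul \<Longrightarrow> open U \<Longrightarrow> openin (weak_topology smul) (f -` U)"
  unfolding weak_topology_def by (rule topology_generated_by_Basis) blast

lemma continuous_map_into_weak_topology:
  assumes "banach_space smul"
    and "\<And>f. f \<in> dual smul \<Longrightarrow> continuous_map X euclidean (\<lambda>x. f (g x))"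
  shows "continuous_map X (weak_topology smul) g"
proof -
  have "openin X (g -` (f -` U) \<inter> topspace X)" if "f \<in> dual smul" "open U" for f U
  proof -
    have "openin X {x \<in> topspace X. f (g x) \<in> U}"
      using assms(2)[OF that(1)] that(2) by (simp add: continuous_map_def)
    moreover have "{x \<in> topspace X. f (g x) \<in> U} = g -` (f -` U) \<inter> topspace X" by auto
    ultimately show ?thesis by simp
  qed
  moreover have "g ` topspace X \<subseteq> \<Union>{f -` U | f U. f \<in> dual smul \<and> open U}"
    using topspace_weak_topology[OF assms(1)]
    unfolding weak_topology_def topology_generated_by_topspace by auto
  ultimately show ?thesis
    unfolding weak_topology_def continuous_on_generated_topo_iff by blast
qed

text \<open>With \<open>\<phi>\<close> zero and \<open>c = 1\<close> the infimal convolution is the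
  distance to \<open>A\<close>. A real part that is nonpositive on a subspace forces the functional
  to vanish there, by rotating its values.\<close>

lemma dual_separates_subspace:
  assumes smul: "banach_space smul" and A: "module.subspace smul A"
    and d: "\<And>y. y \<in> A \<Longrightarrow> d \<le> norm (x - y)"
  obtains f where "f \<in> dual smul" "\<forall>x. norm (f x) \<le> norm x" "\<forall>y\<in>A. f y = 0"
    "d \<le> norm (f x)"
proof -
  obtain f where f: "f \<in> dual smul" "\<And>x. norm (f x) \<le> 1 * norm x"
    "\<And>y. y \<in> A \<Longrightarrow> real_part (f y) \<le> 0" "d \<le> real_part (f x)"
    by (rule hahn_banach_inf_convolution[OF smul A, of 1 "\<lambda>x. 0" d x]) (use d in auto)
  have "f y = 0" if "y \<in> A" for y
  proof -
    obtain w where w: "norm w = 1" "w * f y = of_real (norm (f y))" by (rule phase_exists)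
    have "smul w y \<in> A"
      using module.subspace_scale[OF banach_spaceD(2)[OF smul] A that] .
    then have "norm (f y) \<le> 0"
      using f(3) dualD(2)[OF f(1), of w y] w by fastforce
    then show ?thesis by simp
  qed
  moreover have "d \<le> norm (f x)" using f(4) real_part_le order_trans by blast
  ultimately show ?thesis using that f by simp
qed

lemma norming_functional:
  assumes smul: "banach_space smul"
  obtains f where "f \<in> dual smul" "\<And>x. norm (f x) \<le> norm x" "norm (f x) = norm x"
proof -
  have "module.subspace smul {0}"
    by (rule module.subspace_single_0[OF banach_spaceD(2)[OF smul]])
  from dual_separates_subspace[OF smul this, of "norm x" x]
  obtain f where "f \<in> dual smul" "\<And>x. norm (f x) \<le> norm x" "norm x \<le> norm (f x)"
    by auto
  then show ?thesis using that by (metis antisym)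
qed

lemma dual_separates_points:
  fixes smul :: "'k::real_or_complex \<Rightarrow> 'a::banach \<Rightarrow> 'a"
  assumes smul: "banach_space smul" and "\<And>f. f \<in> dual smul \<Longrightarrow> f x = f y"
  shows "x = y"
proof -
  obtain f where "f \<in> dual smul" "norm (f (x - y)) = norm (x - y)"
    by (rule norming_functional[OF smul]) blast
  then show ?thesis using assms(2)[of f] dualD(3) by fastforce
qed

lemma Hausdorff_weak_topology:
  fixes smul :: "'k::real_or_complex \<Rightarrow> 'a::banach \<Rightarrow> 'a"
  assumes smul: "banach_space smul" shows "Hausdorff_space (weak_topology smul)"
  unfolding Hausdorff_space_def
proof (intro allI impI, elim conjE)
  fix x y :: 'a assume "x \<noteq> y"
  then obtain f where f: "f \<in> dual smul" "f x \<noteq> f y"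
    using dual_separates_points[OF smul] by blast
  from hausdorff[OF f(2)] obtain U V where "open U" "open V" "f x \<in> U" "f y \<in> V" "U \<inter> V = {}"
    by blast
  then show "\<exists>U V. openin (weak_topology smul) U \<and> openin (weak_topology smul) V \<and>
      x \<in> U \<and> y \<in> V \<and> disjnt U V"
    by (intro exI[of _ "f -` U"] exI[of _ "f -` V"])
      (auto simp: openin_weak_topology_vimage f disjnt_def)
qed

text \<open>The evaluation map embeds \<open>B\<close> into a product of compact balls; reflexivity and the
  separation hypothesis make its image closed.\<close>

theorem reflexive_imp_weakly_compact:
  fixes smul :: "'k::real_or_complex \<Rightarrow> 'a::banach \<Rightarrow> 'a"
  assumes smul: "banach_space smul" and refl: "reflexive smul"
    and R: "\<And>x. x \<in> B \<Longrightarrow> norm x \<le> R"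
    and sep: "\<And>x. x \<notin> B \<Longrightarrow> \<exists>f\<in>dual smul. \<exists>r. (\<forall>b\<in>B. norm (f b) \<le> r) \<and> r < norm (f x)"
  shows "compactin (weak_topology smul) B"
proof -
  define D where "D = dual smul"
  define Pr where "Pr = product_topology (\<lambda>f. euclidean :: 'k topology) D"
  define C where "C = (\<Pi>\<^sub>E f\<in>D. cball (0::'k) (R * onorm f))"
  define J where "J x = restrict (\<lambda>f. f x) D" for x
  have J: "J x f = f x" if "f \<in> D" for x f using that by (simp add: J_def)
  have topPr: "topspace Pr = (\<Pi>\<^sub>E f\<in>D. UNIV)" by (simp add: Pr_def)
  have C: "compactin Pr C" unfolding C_def Pr_def compactin_PiE
    by (auto simp: compact_cball_scalar)
  have proj: "continuous_map Pr euclidean (\<lambda>\<phi>. \<phi> f)" if "f \<in> D" for f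
    unfolding Pr_def using continuous_map_product_projection[OF that] by blast
  have bl: "bounded_linear f" if "f \<in> D" for f using that dualD(6) unfolding D_def by blast
  have JC: "J ` B \<subseteq> C"
    unfolding C_def
  proof (intro image_subsetI PiE_I)
    fix x f assume x: "x \<in> B" and f: "f \<in> D"
    have "norm (f x) \<le> onorm f * norm x" by (rule onorm[OF bl[OF f]])
    also have "\<dots> \<le> onorm f * R" by (intro mult_left_mono R x onorm_pos_le bl f)
    finally show "J x f \<in> cball 0 (R * onorm f)" by (simp add: J[OF f] mult.commute)
  next
    fix x f assume "f \<notin> D"
    then show "J x f = undefined" by (simp add: J_def)
  qed
  have closed: "closedin Pr {\<phi> \<in> topspace Pr. g \<phi> \<in> S}"
    if "continuous_map Pr euclidean g" "closed S" for g :: "_ \<Rightarrow> 'k" and S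
    using closedin_continuous_map_preimage[OF that(1), of S] that(2) by simp
  \<comment> \<open>Closed conditions on coordinates pass from evaluations at points of
    \<open>B\<close> to the closure: \<open>S = {0}\<close> transfers linearity, a closed ball
    transfers a bound.\<close>
  have limit: "g \<phi> \<in> S" if "\<phi> \<in> Pr closure_of (J ` B)" "continuous_map Pr euclidean g" "closed S"
    "\<And>x. x \<in> B \<Longrightarrow> g (J x) \<in> S" for g :: "_ \<Rightarrow> 'k" and S \<phi>
  proof -
    have "J ` B \<subseteq> {\<phi> \<in> topspace Pr. g \<phi> \<in> S}"
      using that(4) by (auto simp: topPr J_def)
    then show ?thesis using closure_of_minimal[OF _ closed[OF that(2,3)]] that(1) by blast
  qed
  have "Pr closure_of (J ` B) \<subseteq> J ` B"
  proof
    fix \<phi> assume \<phi>: "\<phi> \<in> Pr closure_of (J ` B)"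
    then have top: "\<phi> \<in> (\<Pi>\<^sub>E f\<in>D. UNIV)"
      using subsetD[OF closure_of_subset_topspace] by (simp only: topPr[symmetric])
    have "\<phi> \<in> bidual smul"
      unfolding bidual_def
    proof (intro CollectI conjI ballI allI)
      fix f g assume fg: "f \<in> dual smul" "g \<in> dual smul"
      then have D: "f \<in> D" "g \<in> D" "(\<lambda>x. f x + g x) \<in> D"
        by (auto simp: D_def add_in_dual[OF smul])
      have "(\<lambda>\<phi>. \<phi> (\<lambda>x. f x + g x) - (\<phi> f + \<phi> g)) \<phi> \<in> {0}"
        by (rule limit[OF \<phi> continuous_map_diff[OF proj[OF D(3)]
              continuous_map_add[OF proj[OF D(1)] proj[OF D(2)]]]])
          (simp_all add: J[OF D(1)] J[OF D(2)] J[OF D(3)])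
      then show "\<phi> (\<lambda>x. f x + g x) = \<phi> f + \<phi> g" by simp
    next
      fix c f assume f: "f \<in> dual smul"
      then have D: "f \<in> D" "(\<lambda>x. c * f x) \<in> D"
        by (auto simp: D_def scale_in_dual[OF smul])
      have "continuous_map Pr euclidean ((\<lambda>z. c * z) \<circ> (\<lambda>\<phi>. \<phi> f))"
        by (rule continuous_map_compose[OF proj[OF D(1)]]) (auto intro!: continuous_intros)
      then have cont: "continuous_map Pr euclidean (\<lambda>\<phi>. c * \<phi> f)" by (simp only: comp_def)
      have "(\<lambda>\<phi>. \<phi> (\<lambda>x. c * f x) - c * \<phi> f) \<phi> \<in> {0}"
        by (rule limit[OF \<phi> continuous_map_diff[OF proj[OF D(2)] cont]])
          (simp_all add: J[OF D(1)] J[OF D(2)])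
      then show "\<phi> (\<lambda>x. c * f x) = c * \<phi> f" by simp
    next
      have "norm (\<phi> f) \<le> R * onorm f" if "f \<in> dual smul" for f
      proof -
        have D: "f \<in> D" using that by (simp add: D_def)
        have "(\<lambda>\<phi>. \<phi> f) \<phi> \<in> cball 0 (R * onorm f)"
          by (rule limit[OF \<phi> proj[OF D]]) (use JC D in \<open>auto simp: C_def PiE_def Pi_def\<close>)
        then show ?thesis by simp
      qed
      then show "\<exists>C. \<forall>f\<in>dual smul. norm (\<phi> f) \<le> C * onorm f" by blast
    qed
    then obtain x where x: "\<And>f. f \<in> D \<Longrightarrow> \<phi> f = f x"
      using refl unfolding reflexive_def D_def by blast
    have "x \<in> B"
    proof (rule ccontr)
      assume "x \<notin> B"
      then obtain f r where f: "f \<in> D" "\<And>b. b \<in> B \<Longrightarrow> norm (f b) \<le> r" "r < norm (f x)"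
        using sep unfolding D_def by blast
      have "(\<lambda>\<phi>. \<phi> f) \<phi> \<in> cball 0 r"
        by (rule limit[OF \<phi> proj[OF f(1)]]) (use f in \<open>auto simp: J\<close>)
      then show False using f(3) x[OF f(1)] by simp
    qed
    moreover have "\<phi> = J x"
      using top x by (auto simp: J_def restrict_def PiE_def extensional_def fun_eq_iff)
    ultimately show "\<phi> \<in> J ` B" by blast
  qed
  then have "closedin Pr (J ` B)"
    using closure_of_subset_eq[of "J ` B" Pr] by (auto simp: topPr J_def)
  then have K: "compactin Pr (J ` B)" using closed_compactin[OF C JC] by blast
  have inj: "inj_on J B"
  proof (rule inj_onI)
    fix x y assume "J x = J y"
    then show "x = y" using dual_separates_points[OF smul, of x y] J unfolding D_def by metis
  qed
  \<comment> \<open>Composed with a functional, the inverse of the evaluation map is a coordinate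
    projection, so compactness can be carried back from the product.\<close>
  have "continuous_map (subtopology Pr (J ` B)) (weak_topology smul) (inv_into B J)"
  proof (rule continuous_map_into_weak_topology[OF smul])
    fix f assume "f \<in> dual smul"
    then have f: "f \<in> D" by (simp add: D_def)
    show "continuous_map (subtopology Pr (J ` B)) euclidean (\<lambda>\<phi>. f (inv_into B J \<phi>))"
      by (rule continuous_map_eq[OF continuous_map_from_subtopology[OF proj[OF f]]])
        (auto simp: inv_into_f_f[OF inj] J[OF f])
  qed
  moreover have "compactin (subtopology Pr (J ` B)) (J ` B)"
    using K by (simp add: compactin_subtopology)
  ultimately have "compactin (weak_topology smul) (inv_into B J ` J ` B)"
    using image_compactin by blast
  moreover have "inv_into B J ` J ` B = B" using inj by simp
  ultimately show ?thesis by simp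
qed

section \<open>Unit balls of subspaces with a stronger norm\<close>

text \<open>The conditions on all of the type are there because \<^locale>\<open>Metric_space\<close> asks for a
  distance that is nonnegative and symmetric outside its carrier, too.\<close>

definition normed_space_on ::
  "('k::real_normed_field \<Rightarrow> 'a::ab_group_add \<Rightarrow> 'a) \<Rightarrow> 'a set \<Rightarrow> ('a \<Rightarrow> real) \<Rightarrow> bool" where
  "normed_space_on smul A N \<longleftrightarrow>
     module smul \<and> module.subspace smul A \<and> (\<forall>x. 0 \<le> N x \<and> N (- x) = N x) \<and>
     (\<forall>x\<in>A. 0 \<le> N x \<and> (N x = 0 \<longleftrightarrow> x = 0)) \<and>
     (\<forall>x\<in>A. \<forall>y\<in>A. N (x + y) \<le> N x + N y) \<and>
     (\<forall>c. \<forall>x\<in>A. N (smul c x) = norm c * N x)"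

lemma normed_space_onD:
  assumes "normed_space_on smul A N"
  shows "module smul" "module.subspace smul A" "0 \<in> A"
    "x \<in> A \<Longrightarrow> y \<in> A \<Longrightarrow> x + y \<in> A" "x \<in> A \<Longrightarrow> y \<in> A \<Longrightarrow> x - y \<in> A"
    "x \<in> A \<Longrightarrow> smul c x \<in> A"
    "x \<in> A \<Longrightarrow> 0 \<le> N x" "x \<in> A \<Longrightarrow> N x = 0 \<longleftrightarrow> x = 0"
    "x \<in> A \<Longrightarrow> y \<in> A \<Longrightarrow> N (x + y) \<le> N x + N y"
    "x \<in> A \<Longrightarrow> N (smul c x) = norm c * N x"
    "N (x - y) = N (y - x)"
    "x \<in> A \<Longrightarrow> y \<in> A \<Longrightarrow> N (x - y) \<le> N x + N y"
    "0 \<le> N x"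
proof -
  show md: "module smul" and sub: "module.subspace smul A"
    using assms by (auto simp: normed_space_on_def)
  show "0 \<in> A" by (rule module.subspace_0[OF md sub])
  show "x \<in> A \<Longrightarrow> y \<in> A \<Longrightarrow> x + y \<in> A" by (rule module.subspace_add[OF md sub])
  show diff: "x \<in> A \<Longrightarrow> y \<in> A \<Longrightarrow> x - y \<in> A" for x y by (rule module.subspace_diff[OF md sub])
  show "x \<in> A \<Longrightarrow> smul c x \<in> A" by (rule module.subspace_scale[OF md sub])
  show "x \<in> A \<Longrightarrow> 0 \<le> N x" "x \<in> A \<Longrightarrow> N x = 0 \<longleftrightarrow> x = 0"
    and hom: "x \<in> A \<Longrightarrow> N (smul c x) = norm c * N x" for x c
    using assms by (auto simp: normed_space_on_def)
  show add: "x \<in> A \<Longrightarrow> y \<in> A \<Longrightarrow> N (x + y) \<le> N x + N y" for x y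
    using assms by (auto simp: normed_space_on_def)
  have neg: "smul (-1) z = - z" for z
    using module.scale_minus_left[OF md, of 1 z] md by (simp add: module_def)
  show "N (x - y) = N (y - x)" "0 \<le> N x"
    using assms unfolding normed_space_on_def by (metis minus_diff_eq, blast)
  show "x \<in> A \<Longrightarrow> y \<in> A \<Longrightarrow> N (x - y) \<le> N x + N y"
    using add[of x "- y"] hom[of y "-1"] module.subspace_neg[OF md sub, of y] by (simp add: neg)
qed

text \<open>Hahn-Banach with \<open>\<phi> = N\<close> and a large multiple of the ambient norm. The
  functional stays below \<open>N\<close> on \<open>A\<close>, and it exceeds 1 at \<open>x\<close>
  provided \<open>N y + c * norm (x - y)\<close> is at least \<open>1 + s\<close> for all
  \<open>y\<close> in \<open>A\<close>: points with small \<open>N\<close> are far from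
  \<open>x\<close>, and for the others \<open>N\<close> alone is large enough.\<close>

lemma dual_separates_ball:
  fixes smul :: "'k::real_or_complex \<Rightarrow> 'a::banach \<Rightarrow> 'a"
  assumes smul: "banach_space smul" and A: "normed_space_on smul A N"
    and C: "0 < C" "\<And>x. x \<in> A \<Longrightarrow> norm x \<le> C * N x"
    and x: "x \<notin> closure {y \<in> A. N y \<le> 1}"
  obtains f where "f \<in> dual smul" "\<And>y. y \<in> A \<Longrightarrow> N y \<le> 1 \<Longrightarrow> norm (f y) \<le> 1" "1 < norm (f x)"
proof -
  note A_D = normed_space_onD[OF A]
  have real: "N (r *\<^sub>R y) = \<bar>r\<bar> * N y" "r *\<^sub>R y \<in> A" if "y \<in> A" for r y
    using A_D(10)[OF that, of "of_real r"] A_D(6)[OF that, of "of_real r"]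
    by (auto simp: banach_spaceD(3)[OF smul])
  obtain \<eta> where \<eta>: "\<eta> > 0" "\<And>y. y \<in> A \<Longrightarrow> N y \<le> 1 \<Longrightarrow> \<eta> \<le> norm (x - y)"
    using x unfolding closure_approachable by (force simp: dist_norm norm_minus_commute not_less)
  \<comment> \<open>A point with \<open>N y \<le> 1 + s\<close> is within
    \<open>C * s = \<eta> / 2\<close> of the ball, hence at distance at least
    \<open>\<eta> / 2\<close> from \<open>x\<close>; the factor \<open>c\<close> makes this distance
    worth \<open>1 + s\<close>.\<close>
  define s where "s = \<eta> / (2 * C)"
  define c where "c = 2 * (1 + s) / \<eta>"
  have s: "s > 0" "C * s = \<eta> / 2" and c: "c > 0" "c * (\<eta> / 2) = 1 + s"
    using C \<eta> by (auto simp: s_def c_def field_simps add_pos_pos)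
  have t: "1 + s \<le> N y + c * norm (x - y)" if y: "y \<in> A" for y
  proof (cases "N y \<le> 1 + s")
    case True
    have "\<eta> / 2 \<le> norm (x - y)"
    proof (cases "N y \<le> 1")
      case True
      then show ?thesis using \<eta>(2)[OF y] \<eta>(1) by simp
    next
      case False
      define y' where "y' = inverse (N y) *\<^sub>R y"
      have "y' \<in> A" "N y' \<le> 1" using real[OF y, of "inverse (N y)"] False by (auto simp: y'_def)
      then have 1: "\<eta> \<le> norm (x - y')" by (rule \<eta>(2))
      have "y - y' = (1 - inverse (N y)) *\<^sub>R y" by (simp add: y'_def algebra_simps)
      then have "norm (y - y') = (1 - inverse (N y)) * norm y"
        using False by (simp add: inverse_le_1_iff)
      also have "\<dots> \<le> (1 - inverse (N y)) * (C * N y)"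
        using False by (intro mult_left_mono C(2) y) (simp add: field_simps)
      also have "\<dots> = C * (N y - 1)" using False by (simp add: field_simps)
      also have "\<dots> \<le> C * s" using True C(1) by (intro mult_left_mono) auto
      finally have "norm (y - y') \<le> \<eta> / 2" by (simp add: s)
      then show ?thesis using 1 norm_triangle_ineq[of "x - y" "y - y'"] by simp
    qed
    then have "c * (\<eta> / 2) \<le> c * norm (x - y)" using c(1) by (intro mult_left_mono) auto
    then show ?thesis using c(2) A_D(7)[OF y] by simp
  next
    case False
    then show ?thesis using c(1) by (simp add: add_increasing2)
  qed
  obtain f where f: "f \<in> dual smul" "\<And>y. y \<in> A \<Longrightarrow> real_part (f y) \<le> N y" "1 + s \<le> real_part (f x)"
    by (rule hahn_banach_inf_convolution[OF smul A_D(2), of c N "1 + s" x])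
      (use c A_D t in \<open>auto simp: real intro: order_trans[of _ 0]\<close>)
  have "norm (f y) \<le> 1" if y: "y \<in> A" "N y \<le> 1" for y
  proof -
    obtain w where w: "norm w = 1" "w * f y = of_real (norm (f y))" by (rule phase_exists)
    have "norm (f y) = real_part (f (smul w y))" by (simp add: dualD(2)[OF f(1)] w)
    also have "\<dots> \<le> N (smul w y)" by (rule f(2)[OF A_D(6)[OF y(1)]])
    finally show ?thesis using A_D(10)[OF y(1), of w] y(2) w(1) by simp
  qed
  moreover have "1 < norm (f x)" using f(3) s(1) real_part_le[of "f x"] by linarith
  ultimately show ?thesis using that f(1) by blast
qed

text \<open>The ball is bounded in the ambient norm, and functionals bounded by 1 on it cut out its
  norm closure, as in the bipolar theorem. These are the two conditions of the compactness
  criterion; \<open>A\<close> itself need be neither closed nor reflexive.\<close>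

lemma closed_unit_ball_weakly_compact:
  fixes smul :: "'k::real_or_complex \<Rightarrow> 'a::banach \<Rightarrow> 'a"
  assumes smul: "banach_space smul" and refl: "reflexive smul" and A: "normed_space_on smul A N"
    and C: "0 < C" "\<And>x. x \<in> A \<Longrightarrow> norm x \<le> C * N x"
  shows "compactin (weak_topology smul) (closure {y \<in> A. N y \<le> 1})"
proof (rule reflexive_imp_weakly_compact[OF smul refl])
  have "norm y \<le> C" if "y \<in> A" "N y \<le> 1" for y
  proof -
    have "C * N y \<le> C * 1" using C(1) that(2) by (intro mult_left_mono) auto
    then show ?thesis using C(2)[OF that(1)] by linarith
  qed
  then have "closure {y \<in> A. N y \<le> 1} \<subseteq> cball 0 C" by (intro closure_minimal) auto
  then show "norm x \<le> C" if "x \<in> closure {y \<in> A. N y \<le> 1}" for x using that by auto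
  fix x assume "x \<notin> closure {y \<in> A. N y \<le> 1}"
  from dual_separates_ball[OF smul A C this]
  obtain f where f: "f \<in> dual smul" "\<And>y. y \<in> A \<Longrightarrow> N y \<le> 1 \<Longrightarrow> norm (f y) \<le> 1" "1 < norm (f x)"
    by blast
  have "closed {x. norm (f x) \<le> 1}"
    by (intro closed_Collect_le continuous_intros dualD(5)[OF f(1)])
  then have "closure {y \<in> A. N y \<le> 1} \<subseteq> {x. norm (f x) \<le> 1}"
    by (intro closure_minimal) (use f(2) in auto)
  then show "\<exists>f\<in>dual smul. \<exists>r. (\<forall>b\<in>closure {y \<in> A. N y \<le> 1}. norm (f b) \<le> r) \<and> r < norm (f x)"
    using f by blast
qed

text \<open>If \<open>norm y < d * N y\<close>, rescaling to the ball makes \<open>cont\<close>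
  applicable; otherwise \<open>N y \<le> norm y / d\<close>. Together,
  \<open>norm (h (T y)) \<le> e * N y + c * norm y\<close>. So
  \<open>real_part (h (T y)) + e * N y\<close> is sublinear on \<open>A\<close> and at least
  \<open>- (c * norm y)\<close>, and Hahn-Banach puts a functional on the whole space below it.
  Rotation by phases turns this one-sided bound into the estimate of the norm.\<close>

lemma functional_approximation:
  fixes smulX :: "'k::real_or_complex \<Rightarrow> 'a::banach \<Rightarrow> 'a" and smulZ :: "'k \<Rightarrow> 'z::banach \<Rightarrow> 'z"
  assumes smulX: "banach_space smulX" and smulZ: "banach_space smulZ"
    and A: "normed_space_on smulX A N"
    and T: "bounded_linear_on smulX smulZ A N T"
    and cont: "\<And>e. 0 < e \<Longrightarrow> \<exists>d>0. \<forall>y\<in>A. N y \<le> 1 \<longrightarrow> norm y < d \<longrightarrow> norm (T y) \<le> e"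
    and h: "h \<in> dual smulZ" and e: "0 < e"
  obtains f where "f \<in> dual smulX" "\<And>y. y \<in> A \<Longrightarrow> norm (h (T y) - f y) \<le> e * N y"
proof -
  note A_D = normed_space_onD[OF A]
  have real: "N (r *\<^sub>R y) = \<bar>r\<bar> * N y" "r *\<^sub>R y \<in> A" if "y \<in> A" for r y
    using A_D(10)[OF that, of "of_real r"] A_D(6)[OF that, of "of_real r"]
    by (auto simp: banach_spaceD(3)[OF smulX])
  have Tadd: "T (x + y) = T x + T y" if "x \<in> A" "y \<in> A" for x y
    using T that by (auto simp: bounded_linear_on_def linear_on_def)
  have Tscale: "T (smulX c y) = smulZ c (T y)" if "y \<in> A" for y c
    using T that by (auto simp: bounded_linear_on_def linear_on_def)
  have Treal: "T (r *\<^sub>R y) = r *\<^sub>R T y" if "y \<in> A" for y r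
    using Tscale[OF that, of "of_real r"] by (simp add: banach_spaceD(3)[OF smulX] banach_spaceD(3)[OF smulZ])
  obtain K0 where K0: "\<And>y. y \<in> A \<Longrightarrow> norm (T y) \<le> K0 * N y"
    using T unfolding bounded_linear_on_def by blast
  define K where "K = \<bar>K0\<bar>"
  have K: "K \<ge> 0" "norm (T y) \<le> K * N y" if "y \<in> A" for y
  proof -
    have "K0 * N y \<le> K * N y" using A_D(7)[OF that] by (intro mult_right_mono) (auto simp: K_def)
    then show "norm (T y) \<le> K * N y" using K0[OF that] by linarith
  qed (simp add: K_def)
  obtain H where H: "H > 0" "\<And>z. norm (h z) \<le> H * norm z"
    using bounded_linear.pos_bounded[OF dualD(6)[OF h]] by (metis mult.commute)
  obtain d where d: "d > 0" "\<And>y. y \<in> A \<Longrightarrow> N y \<le> 1 \<Longrightarrow> norm y < d \<Longrightarrow> norm (T y) \<le> e / H"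
    using cont[of "e / H"] e H(1) by auto
  define c where "c = H * K / d"
  have c: "c \<ge> 0" using H d by (auto simp: c_def K_def)
  have main: "norm (h (T y)) \<le> e * N y + c * norm y" if y: "y \<in> A" for y
  proof (cases "norm y < d * N y")
    case True
    then have n: "N y > 0" using d(1) by (smt (verit) norm_ge_zero zero_less_mult_pos)
    let ?y = "inverse (N y) *\<^sub>R y"
    have "?y \<in> A" "N ?y \<le> 1" using real[OF y, of "inverse (N y)"] n by auto
    moreover have "norm ?y < d" using True n by (simp add: field_simps)
    ultimately have "norm (T ?y) \<le> e / H" by (rule d(2))
    then have "norm (T y) \<le> e / H * N y" using n by (simp add: Treal[OF y] field_simps)
    then have "H * norm (T y) \<le> e * N y" using H(1) by (simp add: field_simps)
    then show ?thesis using H(2)[of "T y"] mult_nonneg_nonneg[OF c norm_ge_zero[of y]] by linarith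
  next
    case False
    then have "N y \<le> norm y / d" using d(1) by (simp add: field_simps)
    then have "H * (K * N y) \<le> H * (K * (norm y / d))"
      using H(1) K(1)[OF y] by (intro mult_left_mono) auto
    also have "\<dots> = c * norm y" by (simp add: c_def)
    finally have "H * norm (T y) \<le> c * norm y"
      using mult_left_mono[OF K(2)[OF y], of H] H(1) by linarith
    then show ?thesis using H(2)[of "T y"] mult_nonneg_nonneg[of e "N y"] e A_D(7)[OF y] by linarith
  qed
  define \<phi> where "\<phi> y = real_part (h (T y)) + e * N y" for y
  have "- (c * norm y) \<le> \<phi> y" if "y \<in> A" for y
    using main[OF that] abs_real_part_le[of "h (T y)"] by (auto simp: \<phi>_def abs_le_iff)
  moreover have "\<phi> (x + y) \<le> \<phi> x + \<phi> y" if "x \<in> A" "y \<in> A" for x y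
    using mult_left_mono[OF A_D(9)[OF that], of e] e
    by (simp add: \<phi>_def Tadd[OF that] dualD(1)[OF h] real_part_add algebra_simps)
  moreover have "\<phi> (r *\<^sub>R y) = r * \<phi> y" if "0 \<le> r" "y \<in> A" for r y
    using dualD(2)[OF h, of "of_real r" "T y"] that
    by (simp add: \<phi>_def Treal real banach_spaceD(3)[OF smulZ] real_part_of_real_mult algebra_simps)
  \<comment> \<open>With \<open>t = 0\<close> and \<open>x0 = 0\<close> the last premise repeats the
    lower bound on \<open>\<phi>\<close>; the theorem serves here for domination on
    \<open>A\<close>.\<close>
  ultimately obtain f where f: "f \<in> dual smulX" "\<And>y. y \<in> A \<Longrightarrow> real_part (f y) \<le> \<phi> y"
    using hahn_banach_inf_convolution[OF smulX A_D(2) c, of \<phi> 0 0]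
    by (smt (verit) diff_0 norm_minus_cancel)
  have "norm (h (T y) - f y) \<le> e * N y" if y: "y \<in> A" for y
  proof -
    obtain w where w: "norm w = 1" "w * (f y - h (T y)) = of_real (norm (f y - h (T y)))"
      by (rule phase_exists)
    have "f (smulX w y) = h (T (smulX w y)) + of_real (norm (f y - h (T y)))"
      by (simp add: dualD(2)[OF f(1)] dualD(2)[OF h] Tscale[OF y] w(2)[symmetric] algebra_simps)
    then have "real_part (f (smulX w y)) = real_part (h (T (smulX w y))) + norm (f y - h (T y))"
      by (simp add: real_part_add)
    moreover have "real_part (f (smulX w y)) \<le> \<phi> (smulX w y)" by (rule f(2)[OF A_D(6)[OF y]])
    moreover have "N (smulX w y) = N y" using A_D(10)[OF y, of w] w(1) by simp
    ultimately show ?thesis by (simp add: \<phi>_def norm_minus_commute)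
  qed
  then show ?thesis using that f(1) by blast
qed

theorem weakly_compact_on_if_continuous_on_ball:
  fixes smulX :: "'k::real_or_complex \<Rightarrow> 'a::banach \<Rightarrow> 'a" and smulZ :: "'k \<Rightarrow> 'z::banach \<Rightarrow> 'z"
  assumes smulX: "banach_space smulX" and smulZ: "banach_space smulZ" and refl: "reflexive smulX"
    and A: "normed_space_on smulX A N"
    and C: "0 < C" "\<And>x. x \<in> A \<Longrightarrow> norm x \<le> C * N x"
    and T: "bounded_linear_on smulX smulZ A N T"
    and cont: "\<And>e. 0 < e \<Longrightarrow> \<exists>d>0. \<forall>y\<in>A. N y \<le> 1 \<longrightarrow> norm y < d \<longrightarrow> norm (T y) \<le> e"
  shows "weakly_compact_on smulZ A N T"
proof -
  note A_D = normed_space_onD[OF A]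
  define B where "B = {y \<in> A. N y \<le> 1}"
  have Tlin: "linear_on smulX smulZ A T" using T by (simp add: bounded_linear_on_def)
  have "uniformly_continuous_on B T"
    unfolding uniformly_continuous_on_def
  proof (intro allI impI)
    fix e :: real assume "e > 0"
    then obtain d where d: "d > 0" "\<And>y. y \<in> A \<Longrightarrow> N y \<le> 1 \<Longrightarrow> norm y < d \<Longrightarrow> norm (T y) \<le> e / 3"
      using cont[of "e / 3"] by auto
    have "dist (T y') (T y) < e" if y: "y \<in> B" "y' \<in> B" "dist y' y < d" for y y'
    proof -
      \<comment> \<open>Half the difference of two points of the ball lies in the ball again, so
        continuity at \<open>0\<close> gives uniform continuity. The halving turns
        \<open>e / 3\<close> into \<open>2 * e / 3 < e\<close>.\<close>
      let ?z = "(1/2) *\<^sub>R (y' - y)"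
      have yA: "y \<in> A" "y' \<in> A" "y' - y \<in> A" using y A_D(5) by (auto simp: B_def)
      have z: "?z = smulX (of_real (1/2)) (y' - y)" by (simp only: banach_spaceD(3)[OF smulX])
      have "?z \<in> A" unfolding z by (rule A_D(6)[OF yA(3)])
      moreover have "N ?z \<le> 1"
        unfolding z using A_D(10)[OF yA(3), of "of_real (1/2)"] A_D(12)[OF yA(2,1)] y
        by (simp add: B_def)
      moreover have "norm ?z < d" using y(3) by (simp add: dist_norm) (use norm_ge_zero[of "y' - y"] in linarith)
      ultimately have "norm (T ?z) \<le> e / 3" by (rule d(2))
      moreover have "T ?z = (1/2) *\<^sub>R T (y' - y)"
        unfolding z using Tlin yA(3) by (simp only: linear_on_def banach_spaceD(3)[OF smulZ])
      moreover have "T y' = T (y' - y) + T y"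
        using Tlin yA by (metis diff_add_cancel linear_on_def)
      ultimately show ?thesis using \<open>e > 0\<close> by (simp add: dist_norm)
    qed
    then show "\<exists>d>0. \<forall>x\<in>B. \<forall>x'\<in>B. dist x' x < d \<longrightarrow> dist (T x') (T x) < e" using d(1) by blast
  qed
  then obtain G where G: "uniformly_continuous_on (closure B) G" "\<And>x. x \<in> B \<Longrightarrow> T x = G x"
    using uniformly_continuous_on_extension_on_closure by metis
  then have contG: "continuous_on (closure B) G" by (simp add: uniformly_continuous_imp_continuous)
  have approx: "\<exists>f\<in>dual smulX. \<forall>x\<in>closure B. norm (h (G x) - f x) \<le> e"
    if h: "h \<in> dual smulZ" and e: "e > 0" for h e
  proof -
    obtain f where f: "f \<in> dual smulX" "\<And>y. y \<in> A \<Longrightarrow> norm (h (T y) - f y) \<le> e * N y"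
      using functional_approximation[OF smulX smulZ A T cont h e] by metis
    \<comment> \<open>The error \<open>e * N x\<close> is at most \<open>e\<close> on
      \<open>B\<close>; being a norm-continuous condition in terms of \<open>G\<close>, the bound
      extends to the closure.\<close>
    have "\<forall>x\<in>closure B. norm (h (G x) - f x) \<le> e"
    proof (rule ballI, rule continuous_le_on_closure[where S = B and f = "\<lambda>x. norm (h (G x) - f x)"])
      show "continuous_on (closure B) (\<lambda>x. norm (h (G x) - f x))"
        by (intro continuous_intros dualD(5)[OF f(1)]
            continuous_on_compose2[OF dualD(5)[OF h, of UNIV] contG]) auto
      show "norm (h (G x) - f x) \<le> e" if "x \<in> B" for x
      proof -
        have "x \<in> A" "N x \<le> 1" using that by (auto simp: B_def)
        then have "norm (h (G x) - f x) \<le> e * N x" "e * N x \<le> e * 1"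
          using f(2)[of x] G(2)[OF that] e by (auto intro: mult_left_mono)
        then show ?thesis by linarith
      qed
    qed
    then show ?thesis using f(1) by blast
  qed
  have "continuous_map (subtopology (weak_topology smulX) (closure B)) (weak_topology smulZ) G"
  proof (rule continuous_map_into_weak_topology[OF smulZ])
    fix h assume h: "h \<in> dual smulZ"
    let ?S = "subtopology (weak_topology smulX) (closure B)"
    have top: "topspace ?S = closure B" by (simp add: smulX)
    show "continuous_map ?S euclidean (\<lambda>x. h (G x))"
      unfolding continuous_map_def
    proof (intro conjI allI impI)
      fix U :: "'k set" assume "openin euclidean U"
      then have U: "open U" by simp
      show "openin ?S {x \<in> topspace ?S. h (G x) \<in> U}"
      proof (subst openin_subopen, intro ballI)
        fix x assume "x \<in> {x \<in> topspace ?S. h (G x) \<in> U}"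
        then have x: "x \<in> closure B" "h (G x) \<in> U" using top by auto
        obtain e where e: "e > 0" "ball (h (G x)) e \<subseteq> U" using U x(2) openE by blast
        \<comment> \<open>Three errors, each at most \<open>e / 4\<close>: the approximation at
          \<open>x\<close>, that at \<open>x'\<close>, and the variation of \<open>f\<close> between
          them.\<close>
        obtain f where f: "f \<in> dual smulX" "\<And>x. x \<in> closure B \<Longrightarrow> norm (h (G x) - f x) \<le> e / 4"
          using approx[OF h, of "e / 4"] e(1) by auto
        let ?V = "f -` ball (f x) (e / 4) \<inter> closure B"
        have "openin ?S ?V"
          by (metis openin_subtopology openin_weak_topology_vimage[OF f(1) open_ball])
        moreover have "x \<in> ?V" using x(1) e(1) by simp
        moreover have "?V \<subseteq> {x \<in> topspace ?S. h (G x) \<in> U}"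
        proof
          fix x' assume x': "x' \<in> ?V"
          have "dist (h (G x)) (h (G x')) \<le> norm (h (G x) - f x) + (dist (f x) (f x') + norm (h (G x') - f x'))"
            by (smt (verit) dist_norm dist_triangle dist_commute)
          also have "\<dots> < e" using f(2)[OF x(1)] f(2)[of x'] x' e(1) by simp
          finally show "x' \<in> {x \<in> topspace ?S. h (G x) \<in> U}" using x' e(2) top by auto
        qed
        ultimately show "\<exists>T. openin ?S T \<and> x \<in> T \<and> T \<subseteq> {x \<in> topspace ?S. h (G x) \<in> U}" by blast
      qed
    qed simp
  qed
  moreover have "compactin (subtopology (weak_topology smulX) (closure B)) (closure B)"
    using closed_unit_ball_weakly_compact[OF smulX refl A C] by (simp add: compactin_subtopology B_def)
  ultimately have W: "compactin (weak_topology smulZ) (G ` closure B)"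
    by (rule image_compactin[rotated])
  \<comment> \<open>Hausdorffness makes the compact image closed, so it contains the weak closure of
    the image of \<open>B\<close> under \<open>T\<close>.\<close>
  have "closedin (weak_topology smulZ) (G ` closure B)"
    by (rule compactin_imp_closedin[OF Hausdorff_weak_topology[OF smulZ] W])
  moreover have "T ` B \<subseteq> G ` closure B" using G(2) closure_subset[of B] by force
  ultimately have "weak_topology smulZ closure_of (T ` B) \<subseteq> G ` closure B"
    by (intro closure_of_minimal)
  then show ?thesis
    unfolding weakly_compact_on_def B_def[symmetric]
    by (rule closed_compactin[OF W _ closedin_closure_of])
qed

section \<open>Isomorphic copies of $c_0$\<close>

lemma Metric_space_normed_space_on:
  assumes "normed_space_on smul A N" shows "Metric_space A (\<lambda>x y. N (x - y))"
proof
  note A_D = normed_space_onD[OF assms]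
  show "0 \<le> N (x - y)" "N (x - y) = N (y - x)" for x y by (rule A_D)+
  show "(N (x - y) = 0) = (x = y)" if "x \<in> A" "y \<in> A" for x y
    using A_D(8)[OF A_D(5)[OF that]] by simp
  show "N (x - z) \<le> N (x - y) + N (y - z)" if "x \<in> A" "y \<in> A" "z \<in> A" for x y z
    using A_D(9)[OF A_D(5)[OF that(1,2)] A_D(5)[OF that(2,3)]] by simp
qed

lemma continuous_map_norm_topology:
  assumes "normed_space_on sA A NA" "normed_space_on sB B NB"
  shows "continuous_map (norm_topology A NA) (norm_topology B NB) f \<longleftrightarrow>
    f ` A \<subseteq> B \<and> (\<forall>a\<in>A. \<forall>e>0. \<exists>d>0. \<forall>x. x \<in> A \<and> NA (a - x) < d \<longrightarrow> NB (f a - f x) < e)"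
  unfolding norm_topology_def
  by (rule Metric_space.metric_continuous_map) (rule Metric_space_normed_space_on assms)+

lemma topspace_norm_topology:
  "normed_space_on smul A N \<Longrightarrow> topspace (norm_topology A N) = A"
  unfolding norm_topology_def
  by (rule Metric_space.topspace_mtopology) (rule Metric_space_normed_space_on)

lemma linear_on_diff:
  fixes f :: "'a::ab_group_add \<Rightarrow> 'b::ab_group_add"
  assumes "normed_space_on sA A NA" "linear_on sA sB A f" "x \<in> A" "y \<in> A"
  shows "f (x - y) = f x - f y"
proof -
  have "f ((x - y) + y) = f (x - y) + f y"
    using assms(2,4) normed_space_onD(5)[OF assms(1,3,4)] unfolding linear_on_def by blast
  then show ?thesis by (simp add: eq_diff_eq)
qed

lemma linear_on_zero:
  fixes f :: "'a::ab_group_add \<Rightarrow> 'b::ab_group_add"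
  assumes "normed_space_on sA A NA" "linear_on sA sB A f"
  shows "f 0 = 0"
  using linear_on_diff[OF assms normed_space_onD(3)[OF assms(1)] normed_space_onD(3)[OF assms(1)]] by simp

lemma bounded_imp_continuous_map:
  fixes f :: "'a::ab_group_add \<Rightarrow> 'b::ab_group_add"
  assumes A: "normed_space_on sA A NA" and B: "normed_space_on sB B NB"
    and f: "linear_on sA sB A f" "f ` A \<subseteq> B" and C: "\<And>x. x \<in> A \<Longrightarrow> NB (f x) \<le> C * NA x"
  shows "continuous_map (norm_topology A NA) (norm_topology B NB) f"
  unfolding continuous_map_norm_topology[OF A B]
proof (intro conjI ballI allI impI f(2))
  fix a e :: real and x0 assume x0: "x0 \<in> A" and e: "0 < e"
  define D where "D = \<bar>C\<bar> + 1"
  have "NB (f x0 - f x) < e" if "x \<in> A" "NA (x0 - x) < e / D" for x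
  proof -
    have "NB (f x0 - f x) = NB (f (x0 - x))" by (simp add: linear_on_diff[OF A f(1) x0 that(1)])
    also have "\<dots> \<le> C * NA (x0 - x)" by (rule C[OF normed_space_onD(5)[OF A x0 that(1)]])
    also have "\<dots> \<le> D * NA (x0 - x)"
      using normed_space_onD(13)[OF A] by (intro mult_right_mono) (auto simp: D_def)
    also have "\<dots> < e" using that(2) by (simp add: D_def field_simps)
    finally show ?thesis .
  qed
  moreover have "e / D > 0" using e by (simp add: D_def)
  ultimately show "\<exists>d>0. \<forall>x. x \<in> A \<and> NA (x0 - x) < d \<longrightarrow> NB (f x0 - f x) < e" by blast
qed

text \<open>Continuity at \<open>0\<close> with tolerance 1, after scaling \<open>x\<close> to norm
  \<open>d / 2\<close>, strictly inside the radius.\<close>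

lemma continuous_map_imp_bounded:
  fixes f :: "'a::ab_group_add \<Rightarrow> 'b::ab_group_add" and sA :: "'k::real_normed_field \<Rightarrow> 'a \<Rightarrow> 'a"
  assumes A: "normed_space_on sA A NA" and B: "normed_space_on sB B NB"
    and f: "linear_on sA sB A f" and cont: "continuous_map (norm_topology A NA) (norm_topology B NB) f"
  obtains C where "0 < C" "\<forall>x\<in>A. NB (f x) \<le> C * NA x"
proof -
  note A_D = normed_space_onD[OF A] and B_D = normed_space_onD[OF B]
  have img: "f x \<in> B" if "x \<in> A" for x
    using cont that unfolding continuous_map_norm_topology[OF A B] by blast
  obtain d where d: "d > 0" "\<And>x. x \<in> A \<Longrightarrow> NA (0 - x) < d \<Longrightarrow> NB (f 0 - f x) < 1"
    using cont A_D(3) unfolding continuous_map_norm_topology[OF A B]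
    by (meson zero_less_one)
  have d': "NB (f x) < 1" if "x \<in> A" "NA x < d" for x
    using d(2)[OF that(1)] that(2) linear_on_zero[OF A f] A_D(11)[of 0 x] B_D(11)[of 0 "f x"] by simp
  have "NB (f x) \<le> 2 / d * NA x" if x: "x \<in> A" for x
  proof (cases "x = 0")
    case True
    then show ?thesis using linear_on_zero[OF A f] B_D(8)[OF B_D(3)] A_D(8)[OF A_D(3)] by simp
  next
    case False
    then have n: "NA x > 0" using A_D(7,8)[OF x] by linarith
    define r where "r = d / (2 * NA x)"
    have r: "r > 0" using d(1) n by (simp add: r_def)
    have "NA (sA (of_real r) x) = r * NA x" using A_D(10)[OF x, of "of_real r"] r by simp
    also have "\<dots> < d" using n d(1) by (simp add: r_def)
    finally have "NA (sA (of_real r) x) < d" .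
    then have "NB (f (sA (of_real r) x)) < 1" by (rule d'[OF A_D(6)[OF x]])
    moreover have "f (sA (of_real r) x) = sB (of_real r) (f x)" using f x by (simp add: linear_on_def)
    ultimately have "r * NB (f x) < 1" using B_D(10)[OF img[OF x], of "of_real r"] r by simp
    then show ?thesis using n d(1) by (simp add: r_def field_simps)
  qed
  then show ?thesis using that[of "2 / d"] d(1) by simp
qed

lemma inv_into_linear_on:
  assumes A: "normed_space_on sA A NA" and f: "linear_on sA sB A f" "inj_on f A"
  shows "linear_on sB sA (f ` A) (inv_into A f)"
proof -
  note A_D = normed_space_onD[OF A]
  have "inv_into A f (f x + f y) = x + y" if "x \<in> A" "y \<in> A" for x y
    using inv_into_f_f[OF f(2) A_D(4)[OF that]] f(1) that by (simp add: linear_on_def)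
  moreover have "inv_into A f (sB c (f x)) = sA c x" if "x \<in> A" for x c
    using inv_into_f_f[OF f(2) A_D(6)[OF that]] f(1) that by (simp add: linear_on_def)
  ultimately show ?thesis using f(2) by (auto simp: linear_on_def)
qed

text \<open>Two-sided estimates replace the topological condition. The inverse is recorded too: the
  copy of \<open>c0\<close> arises as an image of \<open>c0\<close>, whereas the required
  isomorphism goes from the copy to \<open>c0\<close>.\<close>

lemma linear_homeomorphism_onI:
  fixes f :: "'a::ab_group_add \<Rightarrow> 'b::ab_group_add"
  assumes A: "normed_space_on sA A NA" and B: "normed_space_on sB (f ` A) NB"
    and f: "linear_on sA sB A f" and C: "\<And>x. x \<in> A \<Longrightarrow> NB (f x) \<le> C * NA x"
    and c: "0 < c" "\<And>x. x \<in> A \<Longrightarrow> c * NA x \<le> NB (f x)"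
  shows "linear_homeomorphism_on sA sB A NA (f ` A) NB f"
    and "linear_homeomorphism_on sB sA (f ` A) NB A NA (inv_into A f)"
proof -
  note A_D = normed_space_onD[OF A] and B_D = normed_space_onD[OF B]
  have inj: "inj_on f A"
  proof (rule inj_onI)
    fix x y assume xy: "x \<in> A" "y \<in> A" "f x = f y"
    have "c * NA (x - y) \<le> NB 0"
      using c(2)[OF A_D(5)[OF xy(1,2)]] linear_on_diff[OF A f xy(1,2)] xy(3) by simp
    then have "NA (x - y) = 0"
      using B_D(8)[OF B_D(3)] c(1) A_D(13)[of "x - y"] by (simp add: mult_le_0_iff)
    then show "x = y" using A_D(8)[OF A_D(5)[OF xy(1,2)]] by simp
  qed
  have lin': "linear_on sB sA (f ` A) (inv_into A f)" by (rule inv_into_linear_on[OF A f inj])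
  have 1: "continuous_map (norm_topology A NA) (norm_topology (f ` A) NB) f"
    by (rule bounded_imp_continuous_map[OF A B f _ C]) auto
  have 2: "continuous_map (norm_topology (f ` A) NB) (norm_topology A NA) (inv_into A f)"
  proof (rule bounded_imp_continuous_map[OF B A lin', where C = "inverse c"])
    show "NA (inv_into A f y) \<le> inverse c * NB y" if "y \<in> f ` A" for y
      using that c by (auto simp: inj field_simps)
  qed (use inj in auto)
  have "homeomorphic_maps (norm_topology A NA) (norm_topology (f ` A) NB) f (inv_into A f)"
    using 1 2 inj
    by (auto simp: homeomorphic_maps_def topspace_norm_topology[OF A] topspace_norm_topology[OF B])
  then show "linear_homeomorphism_on sA sB A NA (f ` A) NB f"
    "linear_homeomorphism_on sB sA (f ` A) NB A NA (inv_into A f)"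
    using f lin' by (auto simp: linear_homeomorphism_on_def homeomorphic_maps_map)
qed

lemma linear_homeomorphism_onE:
  fixes f :: "'a::ab_group_add \<Rightarrow> 'b::ab_group_add"
    and sA :: "'k::real_normed_field \<Rightarrow> 'a \<Rightarrow> 'a"
  assumes A: "normed_space_on sA A NA" and B: "normed_space_on sB B NB"
    and h: "linear_homeomorphism_on sA sB A NA B NB f"
  obtains g C c where "linear_on sB sA B g" "0 < C" "0 < c"
    "\<forall>y\<in>B. g y \<in> A" "\<forall>y\<in>B. f (g y) = y" "\<forall>x\<in>A. g (f x) = x" "\<forall>x\<in>A. f x \<in> B"
    "\<forall>y\<in>B. NA (g y) \<le> C * NB y" "\<forall>x\<in>A. NB (f x) \<le> c * NA x"
proof -
  note A_D = normed_space_onD[OF A] and B_D = normed_space_onD[OF B]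
  obtain g where maps: "homeomorphic_maps (norm_topology A NA) (norm_topology B NB) f g"
    and f: "linear_on sA sB A f"
    using h by (auto simp: linear_homeomorphism_on_def homeomorphic_map_maps)
  then have cont: "continuous_map (norm_topology A NA) (norm_topology B NB) f"
    "continuous_map (norm_topology B NB) (norm_topology A NA) g"
    and gf: "\<And>x. x \<in> A \<Longrightarrow> g (f x) = x" and fg: "\<And>y. y \<in> B \<Longrightarrow> f (g y) = y"
    by (auto simp: homeomorphic_maps_def topspace_norm_topology[OF A] topspace_norm_topology[OF B])
  have fB: "\<And>x. x \<in> A \<Longrightarrow> f x \<in> B" and gA: "\<And>y. y \<in> B \<Longrightarrow> g y \<in> A"
    using conjunct1[OF cont(1)[unfolded continuous_map_norm_topology[OF A B]]]
      conjunct1[OF cont(2)[unfolded continuous_map_norm_topology[OF B A]]]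
    by auto
  have g: "linear_on sB sA B g"
    unfolding linear_on_def
  proof (intro conjI ballI allI)
    show "g (x + y) = g x + g y" if "x \<in> B" "y \<in> B" for x y
      using gf[OF A_D(4)[OF gA[OF that(1)] gA[OF that(2)]]] f gA[OF that(1)] gA[OF that(2)] fg that
      by (simp add: linear_on_def)
    show "g (sB c x) = sA c (g x)" if "x \<in> B" for c x
      using gf[OF A_D(6)[OF gA[OF that]]] f gA[OF that] fg that by (simp add: linear_on_def)
  qed
  obtain c where c: "0 < c" "\<forall>x\<in>A. NB (f x) \<le> c * NA x"
    by (rule continuous_map_imp_bounded[OF A B f cont(1)])
  obtain C where C: "0 < C" "\<forall>y\<in>B. NA (g y) \<le> C * NB y"
    by (rule continuous_map_imp_bounded[OF B A g cont(2)])
  show ?thesis using gA fg gf fB by (intro that[OF g C(1) c(1) _ _ _ _ C(2) c(2)]) auto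
qed

lemma normed_space_on_subspace:
  "normed_space_on smul A N \<Longrightarrow> module.subspace smul F \<Longrightarrow> F \<subseteq> A \<Longrightarrow> normed_space_on smul F N"
  unfolding normed_space_on_def by (simp add: subset_iff)

lemma normed_space_on_banach_space:
  assumes "banach_space smul" "module.subspace smul F"
  shows "normed_space_on smul F norm"
  using assms banach_spaceD[OF assms(1)] norm_triangle_ineq by (auto simp: normed_space_on_def)

lemma linear_on_image_subspace:
  assumes sA: "normed_space_on sA A NA" and mB: "module sB" and f: "linear_on sA sB A f"
  shows "module.subspace sB (f ` A)"
proof -
  note A_D = normed_space_onD[OF sA]
  have "0 \<in> f ` A"
  proof -
    have "f (sA 0 0) = sB 0 (f 0)" using f A_D(3) by (simp add: linear_on_def)
    then have "f (sA 0 0) = 0" by (simp add: module.scale_zero_left[OF mB])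
    then show ?thesis using A_D(6)[OF A_D(3), of 0] by (metis imageI)
  qed
  moreover have "f x + f y \<in> f ` A" if "x \<in> A" "y \<in> A" for x y
    using f that A_D(4)[OF that] unfolding linear_on_def by (metis imageI)
  moreover have "sB c (f x) \<in> f ` A" if "x \<in> A" for x c
    using f that A_D(6)[OF that] unfolding linear_on_def by (metis imageI)
  ultimately show ?thesis by (auto simp: module.subspace_def[OF mB])
qed

section \<open>The sequence space \<open>c0\<close>, and operators that fix a copy of it\<close>

lemma norm_scale_seq: "norm (scale_seq c a) = norm c * norm a"
proof (rule antisym)
  have le: "norm (scale_seq c a) \<le> norm c * norm a" for c :: 'a and a
    by (intro norm_bound) (simp add: apply_scale_seq norm_mult mult_left_mono norm_bounded)
  show "norm (scale_seq c a) \<le> norm c * norm a" by (rule le)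
  show "norm c * norm a \<le> norm (scale_seq c a)"
  proof (cases "c = 0")
    case False
    then have "scale_seq (inverse c) (scale_seq c a) = a"
      by (intro bcontfun_eqI) (simp add: apply_scale_seq)
    then have "norm a \<le> norm (inverse c) * norm (scale_seq c a)" by (metis le)
    then have "norm c * norm a \<le> norm c * (norm (inverse c) * norm (scale_seq c a))"
      by (rule mult_left_mono) simp
    also have "\<dots> = norm (scale_seq c a)" using False by (simp add: norm_inverse)
    finally show ?thesis .
  qed simp
qed

lemma module_scale_seq: "module scale_seq"
  by unfold_locales (auto intro!: bcontfun_eqI simp: apply_scale_seq algebra_simps)

lemma normed_space_on_c0: "normed_space_on scale_seq c0 norm"
proof -
  have "module.subspace scale_seq (c0 :: (nat \<Rightarrow>\<^sub>C 'a) set)"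
    unfolding module.subspace_def[OF module_scale_seq] c0_def
    by (auto simp: fun_eq_iff[symmetric] apply_scale_seq[abs_def] plus_bcontfun.rep_eq zero_bcontfun.rep_eq
        intro!: tendsto_mult_right_zero tendsto_add_zero)
  then show ?thesis
    using module_scale_seq norm_scale_seq norm_triangle_ineq by (auto simp: normed_space_on_def)
qed

text \<open>If every point of \<open>K\<close> had a neighbourhood avoided from some index on,
  finitely many of these would cover \<open>K\<close> and a late term would lie in none. Cluster
  points take the place of weakly convergent subsequences.\<close>

lemma compactin_cluster_point:
  assumes K: "compactin X K" and q: "\<And>n::nat. q n \<in> K"
  shows "\<exists>z\<in>K. \<forall>U n. openin X U \<longrightarrow> z \<in> U \<longrightarrow> (\<exists>m\<ge>n. q m \<in> U)"
proof (rule ccontr)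
  assume "\<not> ?thesis"
  then have "\<forall>z\<in>K. \<exists>U n. openin X U \<and> z \<in> U \<and> (\<forall>m\<ge>n. q m \<notin> U)" by simp
  from bchoice[OF this] obtain U
    where "\<forall>z\<in>K. \<exists>n. openin X (U z) \<and> z \<in> U z \<and> (\<forall>m\<ge>n. q m \<notin> U z)" by (rule exE)
  from bchoice[OF this] obtain n
    where U: "\<forall>z\<in>K. openin X (U z) \<and> z \<in> U z \<and> (\<forall>m\<ge>n z. q m \<notin> U z)" by (rule exE)
  have "\<exists>\<F>. finite \<F> \<and> \<F> \<subseteq> U ` K \<and> K \<subseteq> \<Union>\<F>"
    by (rule compactinD[OF K]) (use U in auto)
  then obtain \<F> where \<F>: "finite \<F>" "\<F> \<subseteq> U ` K" "K \<subseteq> \<Union>\<F>" by blast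
  from finite_subset_image[OF \<F>(1,2)] obtain K' where "K' \<subseteq> K" "finite K'" "\<F> = U ` K'"
    by blast
  with \<F>(3) have K': "finite K'" "K' \<subseteq> K" "K \<subseteq> \<Union>(U ` K')" by auto
  \<comment> \<open>Inserting 0 gives \<open>Max\<close> a nonempty set whatever \<open>K'\<close>
    is.\<close>
  define m where "m = Max (insert 0 (n ` K'))"
  obtain z where z: "z \<in> K'" "q m \<in> U z" using q[of m] K'(3) by blast
  have "n z \<le> m" unfolding m_def using K'(1) z(1) by (intro Max_ge) auto
  then show False using U z K'(2) by blast
qed

text \<open>The images of the partial sums of the unit vectors have a weak cluster point, which would
  have to be the image of the constant sequence \<open>1\<close>, outside \<open>c0\<close>.\<close>

theorem not_weakly_compact_on_if_fixes_c0:
  fixes smul :: "'k::real_or_complex \<Rightarrow> 'a::ab_group_add \<Rightarrow> 'a" and smulZ :: "'k \<Rightarrow> 'z::banach \<Rightarrow> 'z"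
  assumes smulZ: "banach_space smulZ" and A: "normed_space_on smul A N"
    and wc: "weakly_compact_on smulZ A N T"
    and F: "module.subspace smul F" "F \<subseteq> A"
    and S: "linear_homeomorphism_on smul scale_seq F N c0 norm S"
    and T: "linear_homeomorphism_on smul smulZ F N (T ` F) norm T"
  shows False
proof -
  have nF: "normed_space_on smul F N" by (rule normed_space_on_subspace[OF A F])
  note c0_D = normed_space_onD[OF normed_space_on_c0[where 'a = 'k]]
  have TF: "linear_on smul smulZ F T" using T by (simp add: linear_homeomorphism_on_def)
  have sT: "module.subspace smulZ (T ` F)"
    by (rule linear_on_image_subspace[OF nF banach_spaceD(2)[OF smulZ] TF])
  have nT: "normed_space_on smulZ (T ` F) norm" by (rule normed_space_on_banach_space[OF smulZ sT])
  obtain g C c' where "linear_on scale_seq smul c0 g" "0 < C" "0 < c'"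
    "\<forall>y\<in>c0. g y \<in> F" "\<forall>y\<in>c0. S (g y) = y" "\<forall>x\<in>F. g (S x) = x" "\<forall>x\<in>F. S x \<in> c0"
    "\<forall>y\<in>c0. N (g y) \<le> C * norm y" "\<forall>x\<in>F. norm (S x) \<le> c' * N x"
    by (rule linear_homeomorphism_onE[OF nF normed_space_on_c0 S])
  note g = this(1-3) this(4-)[rule_format]
  obtain k D d where "linear_on smulZ smul (T ` F) k" "0 < D" "0 < d"
    "\<forall>y\<in>T ` F. k y \<in> F" "\<forall>y\<in>T ` F. T (k y) = y" "\<forall>x\<in>F. k (T x) = x" "\<forall>x\<in>F. T x \<in> T ` F"
    "\<forall>y\<in>T ` F. N (k y) \<le> D * norm y" "\<forall>x\<in>F. norm (T x) \<le> d * N x"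
    by (rule linear_homeomorphism_onE[OF nF nT T])
  note k = this(1-3) this(4-)[rule_format]
  define W where "W a = T (g a)" for a
  have Wadd: "W (a + b) = W a + W b" if "a \<in> c0" "b \<in> c0" for a b
    using that g TF by (simp add: W_def linear_on_def)
  have Wscale: "W (scale_seq t a) = smulZ t (W a)" if "a \<in> c0" for a t
    using that g TF by (simp add: W_def linear_on_def)
  have Wlin: "linear_on scale_seq smulZ c0 W" using Wadd Wscale by (simp add: linear_on_def)
  note Wdiff = linear_on_diff[OF normed_space_on_c0 Wlin]
  \<comment> \<open>From \<open>norm a \<le> c' * N (g a)\<close> and
    \<open>N (g a) \<le> D * norm (W a)\<close>: the lower bound of \<open>W\<close>.\<close>
  define c where "c = inverse (c' * D)"
  have c: "c > 0" using g(3) k(2) by (simp add: c_def)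
  have low: "c * norm a \<le> norm (W a)" if a: "a \<in> c0" for a
  proof -
    have "norm a \<le> c' * N (g a)" using g(9)[OF g(4)[OF a]] g(5)[OF a] by simp
    also have "N (g a) \<le> D * norm (W a)"
      using k(8)[of "W a"] k(6)[OF g(4)[OF a]] g(4)[OF a] by (simp add: W_def)
    finally show ?thesis using g(3) k(2) by (simp add: c_def field_simps)
  qed
  define s where "s n = Bcontfun (\<lambda>i. if i < n then 1 else 0 :: 'k)" for n :: nat
  have sn: "apply_bcontfun (s n) = (\<lambda>i. if i < n then 1 else 0 :: 'k)" for n
  proof -
    have "bounded (range (\<lambda>i. if i < n then 1 else 0 :: 'k))"
      by (rule boundedI[where B = 1]) auto
    then show ?thesis unfolding s_def by (intro Bcontfun_inverse) (simp add: bcontfun_def)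
  qed
  have ev0: "\<forall>\<^sub>F i in sequentially. (if i < n then 1 else 0 :: 'k) = 0" for n
    using eventually_ge_at_top[of n] by eventually_elim simp
  have s0: "s n \<in> c0" for n
    unfolding c0_def sn mem_Collect_eq by (rule tendsto_eventually[OF ev0])
  have norm_s: "norm (s n) \<le> 1" for n by (rule norm_bound) (simp add: sn)
  \<comment> \<open>Scaling by \<open>1 / C\<close> brings the preimages of the partial sums
    \<open>s n\<close> into the unit ball of \<open>N\<close>.\<close>
  define t :: 'k where "t = of_real (inverse C)"
  have norm_t: "norm t = inverse C" using g(2) unfolding t_def norm_of_real by simp
  define q where "q n = W (scale_seq t (s n))" for n
  have ts: "scale_seq t (s n) \<in> c0" for n by (rule c0_D(6)[OF s0])
  define K where "K = weak_topology smulZ closure_of (T ` {x \<in> A. N x \<le> 1})"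
  have K: "compactin (weak_topology smulZ) K" using wc by (simp add: weakly_compact_on_def K_def)
  have "q n \<in> K" for n
  proof -
    have "N (g (scale_seq t (s n))) \<le> C * norm (scale_seq t (s n))" by (rule g(8)[OF ts])
    also have "\<dots> = norm (s n)" using g(2) by (simp add: norm_scale_seq norm_t)
    finally have "q n \<in> T ` {x \<in> A. N x \<le> 1}"
      unfolding q_def W_def using g(4)[OF ts] F(2) norm_s[of n] by fastforce
    moreover have "T ` {x \<in> A. N x \<le> 1} \<subseteq> K"
      unfolding K_def by (rule closure_of_subset) (simp add: smulZ)
    ultimately show ?thesis by blast
  qed
  from compactin_cluster_point[OF K this]
  obtain z where z: "\<forall>U n. openin (weak_topology smulZ) U \<longrightarrow> z \<in> U \<longrightarrow> (\<exists>m\<ge>n. q m \<in> U)"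
    by (rule bexE)
  \<comment> \<open>The complement of a single scalar is open, so a functional that is eventually
    constant along \<open>q\<close> keeps that value at the cluster point.\<close>
  have fz: "f z = v" if f: "f \<in> dual smulZ" "\<And>n. n \<ge> n0 \<Longrightarrow> f (q n) = v" for f n0 v
  proof (rule ccontr)
    assume "f z \<noteq> v"
    then have "openin (weak_topology smulZ) (f -` (- {v}))" "z \<in> f -` (- {v})"
      by (auto intro: openin_weak_topology_vimage[OF f(1)])
    then obtain m where "m \<ge> n0" "q m \<in> f -` (- {v})" using z by blast
    then show False using f(2) by auto
  qed
  \<comment> \<open>A gap \<open>1 / (2 * C)\<close> in one coordinate, seen by a functional of size
    at least \<open>c\<close>, will force this distance between \<open>z\<close> and
    \<open>W a\<close>.\<close>
  define \<eta> where "\<eta> = c / (2 * C)"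
  have \<eta>: "\<eta> > 0" using c g(2) by (simp add: \<eta>_def)
  \<comment> \<open>Otherwise a functional vanishing on the image of \<open>c0\<close>, and hence
    along \<open>q\<close>, would not vanish at \<open>z\<close>.\<close>
  have "\<exists>a\<in>c0. norm (z - W a) < \<eta>"
  proof (rule ccontr)
    assume "\<not> ?thesis"
    then have *: "\<And>y. y \<in> W ` c0 \<Longrightarrow> \<eta> \<le> norm (z - y)" by force
    have sub: "module.subspace smulZ (W ` c0)"
      by (rule linear_on_image_subspace[OF normed_space_on_c0 banach_spaceD(2)[OF smulZ] Wlin])
    obtain f where f: "f \<in> dual smulZ" "\<forall>x. norm (f x) \<le> norm x" "\<forall>y\<in>W ` c0. f y = 0"
      "\<eta> \<le> norm (f z)"
      by (rule dual_separates_subspace[OF smulZ sub *])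
    have "f z = 0" by (rule fz[OF f(1), of 0]) (simp add: q_def f(3) ts)
    then show False using f(4) \<eta> by simp
  qed
  then obtain a where a: "a \<in> c0" "norm (z - W a) < \<eta>" by blast
  have "(\<lambda>m. norm (apply_bcontfun a m)) \<longlonglongrightarrow> 0"
    using a(1) unfolding c0_def mem_Collect_eq by (rule tendsto_norm_zero)
  from order_tendstoD(2)[OF this, of "inverse (2 * C)"] g(2)
  have "\<forall>\<^sub>F m in sequentially. norm (apply_bcontfun a m) < inverse (2 * C)" by simp
  then obtain m where m: "norm (apply_bcontfun a m) < inverse (2 * C)"
    by (auto simp: eventually_sequentially)
  \<comment> \<open>A functional that kills the image of \<open>E\<close> and has modulus at least
    \<open>c\<close> at the image of the unit vector \<open>v\<close> acts on the image of
    \<open>c0\<close> as a multiple of coordinate \<open>m\<close>. So this coordinate can be read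
    off in \<open>Z\<close>.\<close>
  define E where "E = {b \<in> c0 :: (nat \<Rightarrow>\<^sub>C 'k) set. apply_bcontfun b m = 0}"
  have sE: "module.subspace scale_seq E"
    using c0_D(3,4,6) by (auto simp: module.subspace_def[OF module_scale_seq] E_def apply_scale_seq)
  have nE: "normed_space_on scale_seq E norm"
    by (rule normed_space_on_subspace[OF normed_space_on_c0 sE]) (simp add: E_def)
  have subWE: "module.subspace smulZ (W ` E)"
    by (rule linear_on_image_subspace[OF nE banach_spaceD(2)[OF smulZ]])
      (use Wlin in \<open>simp add: linear_on_def E_def\<close>)
  define v where "v = s (Suc m) - s m"
  have v: "v \<in> c0" "apply_bcontfun v m = 1"
    using c0_D(5)[OF s0 s0] by (simp_all add: v_def sn)
  have dist: "c \<le> norm (W v - y)" if y: "y \<in> W ` E" for y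
  proof -
    obtain b where b: "y = W b" "b \<in> c0" "apply_bcontfun b m = 0" using y by (auto simp: E_def)
    have "1 \<le> norm (v - b)" using norm_bounded[of "v - b" m] v b by simp
    then have "c \<le> c * norm (v - b)" using c by simp
    also have "\<dots> \<le> norm (W v - y)" using low[OF c0_D(5)[OF v(1) b(2)]] Wdiff[OF v(1) b(2)] b by simp
    finally show ?thesis .
  qed
  obtain f where f: "f \<in> dual smulZ" "\<forall>x. norm (f x) \<le> norm x" "\<forall>y\<in>W ` E. f y = 0"
    "c \<le> norm (f (W v))"
    by (rule dual_separates_subspace[OF smulZ subWE dist])
  have fW: "f (W b) = apply_bcontfun b m * f (W v)" if b: "b \<in> c0" for b
  proof -
    let ?w = "scale_seq (apply_bcontfun b m) v"
    have w: "?w \<in> c0" by (rule c0_D(6)[OF v(1)])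
    have "b - ?w \<in> E" using c0_D(5)[OF b w] v(2) by (simp add: E_def apply_scale_seq)
    then have "f (W (b - ?w)) = 0" using f(3) by blast
    then show ?thesis
      by (simp add: Wdiff[OF b w] Wscale[OF v(1)] dualD(2,3)[OF f(1)])
  qed
  \<comment> \<open>From \<open>n = Suc m\<close> on, coordinate \<open>m\<close> of
    \<open>s n\<close> equals 1.\<close>
  have "f z = t * f (W v)"
    by (rule fz[OF f(1), of "Suc m"]) (simp add: q_def fW[OF ts] apply_scale_seq sn)
  then have "f (z - W a) = (t - apply_bcontfun a m) * f (W v)"
    by (simp add: dualD(3)[OF f(1)] fW[OF a(1)] algebra_simps)
  then have "norm (t - apply_bcontfun a m) * norm (f (W v)) \<le> norm (z - W a)"
    using f(2)[rule_format, of "z - W a"] by (simp add: norm_mult)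
  moreover have "inverse (2 * C) \<le> norm (t - apply_bcontfun a m)"
  proof -
    have "inverse C - norm (apply_bcontfun a m) \<le> norm (t - apply_bcontfun a m)"
      by (metis norm_t norm_triangle_ineq2)
    moreover have "inverse C = 2 * inverse (2 * C)" by simp
    ultimately show ?thesis using m by linarith
  qed
  then have "inverse (2 * C) * c \<le> norm (t - apply_bcontfun a m) * norm (f (W v))"
    using f(4) c g(2) by (intro mult_mono) auto
  moreover have "inverse (2 * C) * c = \<eta>" by (simp add: \<eta>_def field_simps)
  ultimately show False using a(2) by linarith
qed

section \<open>Uniform boundedness, disjointification and gliding hump\<close>

text \<open>Baire's theorem puts a ball inside one of the closed sets \<open>E n\<close>; moving its
  centre to the origin costs the factor 2.\<close>

theorem uniform_boundedness:
  fixes F :: "('a::banach \<Rightarrow>\<^sub>L 'b::real_normed_vector) set"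
  assumes pw: "\<And>x. \<exists>B. \<forall>L\<in>F. norm (blinfun_apply L x) \<le> B"
  shows "\<exists>D. \<forall>L\<in>F. norm L \<le> D"
proof -
  define E where "E n = {x. \<forall>L\<in>F. norm (blinfun_apply L x) \<le> real n}" for n
  have closed: "closed (E n)" for n
  proof -
    have "E n = (\<Inter>L\<in>F. {x. norm (blinfun_apply L x) \<le> real n})" by (auto simp: E_def)
    moreover have "closed \<dots>" by (intro closed_INT ballI closed_Collect_le continuous_intros)
    ultimately show ?thesis by simp
  qed
  have "(\<Union>n. E n) = UNIV"
  proof -
    have "\<exists>n. x \<in> E n" for x
    proof -
      obtain B where B: "\<forall>L\<in>F. norm (blinfun_apply L x) \<le> B" using pw by blast
      obtain n where "B \<le> real n" using real_arch_simple by blast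
      then show ?thesis using B by (auto simp: E_def intro: order_trans)
    qed
    then show ?thesis by blast
  qed
  moreover have "euclidean interior_of \<Union>(range E) = {}" if "\<And>n. interior (E n) = {}"
    by (rule Baire_category_alt) (use completely_metrizable_space_euclidean closed that in auto)
  ultimately obtain n where "interior (E n) \<noteq> {}" by auto
  then obtain x0 r where r: "r > 0" "cball x0 r \<subseteq> E n"
    by (metis equals0I mem_interior_cball)
  have "norm L \<le> 2 * real n / r" if L: "L \<in> F" for L
  proof (rule norm_blinfun_bound)
    show "0 \<le> 2 * real n / r" using r by simp
    fix x
    show "norm (blinfun_apply L x) \<le> 2 * real n / r * norm x"
    proof (cases "x = 0")
      case False
      define y where "y = (r / norm x) *\<^sub>R x"
      have "x0 + y \<in> cball x0 r" "x0 \<in> cball x0 r" using False r by (auto simp: y_def dist_norm)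
      then have "x0 + y \<in> E n" "x0 \<in> E n" using r(2) by (auto simp del: mem_cball)
      then have "norm (blinfun_apply L (x0 + y)) \<le> n" "norm (blinfun_apply L x0) \<le> n"
        using L by (auto simp: E_def)
      then have "norm (blinfun_apply L y) \<le> 2 * real n"
        using norm_triangle_ineq4[of "blinfun_apply L (x0 + y)" "blinfun_apply L x0"]
        by (simp add: blinfun.add_right)
      then show ?thesis using False r by (simp add: y_def blinfun.scaleR_right field_simps)
    qed simp
  qed
  then show ?thesis by blast
qed

text \<open>Rosenthal's disjointification argument: if no block of a partition of \<open>A\<close> into infinitely
  many infinite blocks works, a diagonal choice lowers the bound on the row sums by \<open>e\<close>.\<close>

lemma rosenthal_aux:
  fixes m :: "nat \<Rightarrow> nat \<Rightarrow> real"
  assumes pos: "\<And>k j. 0 \<le> m k j" and e: "0 < e"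
  shows "infinite A \<Longrightarrow> (\<And>k J. k \<in> A \<Longrightarrow> finite J \<Longrightarrow> J \<subseteq> A \<Longrightarrow> sum (m k) J \<le> real n * e) \<Longrightarrow>
    \<exists>N\<subseteq>A. infinite N \<and> (\<forall>k\<in>N. \<forall>J. finite J \<longrightarrow> J \<subseteq> N - {k} \<longrightarrow> sum (m k) J \<le> e)"
proof (induction n arbitrary: A)
  case 0
  have "sum (m k) J \<le> e" if "k \<in> A" "finite J" "J \<subseteq> A - {k}" for k J
  proof -
    have "J \<subseteq> A" using that(3) by blast
    then show ?thesis using 0(2)[OF that(1,2)] e by simp
  qed
  then show ?case using 0(1) by blast
next
  case (Suc n)
  define N where "N p = range (\<lambda>i. enumerate A (prod_encode (p, i)))" for p
  have inj: "inj (enumerate A)" by (rule strict_mono_imp_inj_on[OF strict_mono_enumerate[OF Suc.prems(1)]])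
  have NA: "N p \<subseteq> A" for p
    unfolding N_def using enumerate_in_set[OF Suc.prems(1)] by blast
  have infN: "infinite (N p)" for p
    unfolding N_def by (rule range_inj_infinite) (auto intro!: injI dest!: injD[OF inj])
  have disj: "p = p'" if x: "x \<in> N p" "x \<in> N p'" for x p p'
  proof -
    obtain i where "x = enumerate A (prod_encode (p, i))" using x(1) by (auto simp: N_def)
    moreover obtain i' where "x = enumerate A (prod_encode (p', i'))" using x(2) by (auto simp: N_def)
    ultimately have "prod_encode (p, i) = prod_encode (p', i')" using inj by (simp add: inj_eq)
    then show ?thesis by simp
  qed
  show ?case
  proof (cases "\<exists>p. \<forall>k\<in>N p. \<forall>J. finite J \<longrightarrow> J \<subseteq> N p - {k} \<longrightarrow> sum (m k) J \<le> e")
    case True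
    then obtain p where "\<forall>k\<in>N p. \<forall>J. finite J \<longrightarrow> J \<subseteq> N p - {k} \<longrightarrow> sum (m k) J \<le> e" by (rule exE)
    then show ?thesis using NA[of p] infN[of p] by (intro exI[of _ "N p"] conjI)
  next
    case False
    then have "\<forall>p. \<exists>k J. k \<in> N p \<and> finite J \<and> J \<subseteq> N p - {k} \<and> e < sum (m k) J"
      by (meson not_le)
    from choice[OF this] obtain k
      where "\<forall>p. \<exists>J. k p \<in> N p \<and> finite J \<and> J \<subseteq> N p - {k p} \<and> e < sum (m (k p)) J" by (rule exE)
    from choice[OF this] obtain J
      where kJ: "\<forall>p. k p \<in> N p \<and> finite (J p) \<and> J p \<subseteq> N p - {k p} \<and> e < sum (m (k p)) (J p)" by (rule exE)
    have "inj k" using kJ disj by (metis injI)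
    then have inf: "infinite (range k)" by (rule range_inj_infinite)
    have kA: "range k \<subseteq> A" using kJ NA by blast
    \<comment> \<open>\<open>J p\<close> lies in the block \<open>N p\<close>, whose only member in
      the range of \<open>k\<close> is \<open>k p\<close>, and \<open>k p\<close> is excluded. So
      \<open>I\<close> and \<open>J p\<close> are disjoint, and \<open>J p\<close> already uses up
      more than \<open>e\<close> of the row sum.\<close>
    have bound: "sum (m k') I \<le> real n * e" if k': "k' \<in> range k" and I: "finite I" "I \<subseteq> range k" for k' I
    proof -
      obtain p where p: "k' = k p" using k' by blast
      have "I \<inter> J p = {}"
      proof (rule ccontr)
        assume "I \<inter> J p \<noteq> {}"
        then obtain x where x: "x \<in> I" "x \<in> J p" by blast
        then obtain p' where p': "x = k p'" using I(2) by blast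
        have "x \<in> N p" "x \<noteq> k p" using x(2) kJ by blast+
        moreover have "x \<in> N p'" using p' kJ by blast
        ultimately show False using disj p' by blast
      qed
      then have "sum (m k') (I \<union> J p) = sum (m k') I + sum (m k') (J p)"
        using I(1) kJ by (intro sum.union_disjoint) auto
      moreover have "I \<union> J p \<subseteq> A" using I(2) kA kJ NA by blast
      then have "sum (m k') (I \<union> J p) \<le> real (Suc n) * e"
        using k' kA I(1) kJ by (intro Suc.prems(2)) auto
      moreover have "e < sum (m k') (J p)" using kJ p by blast
      ultimately show ?thesis by (simp add: algebra_simps)
    qed
    have "\<exists>N\<subseteq>range k. infinite N \<and> (\<forall>k\<in>N. \<forall>J. finite J \<longrightarrow> J \<subseteq> N - {k} \<longrightarrow> sum (m k) J \<le> e)"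
      by (rule Suc.IH[OF inf]) (rule bound)
    then obtain N' where N': "N' \<subseteq> range k" "infinite N'"
      "\<forall>k\<in>N'. \<forall>J. finite J \<longrightarrow> J \<subseteq> N' - {k} \<longrightarrow> sum (m k) J \<le> e" by (elim exE conjE)
    from N'(1) kA have "N' \<subseteq> A" by (rule subset_trans)
    then show ?thesis using N'(2,3) by (intro exI[of _ N'] conjI)
  qed
qed

text \<open>Each failed round lowers the row bound by \<open>e\<close>, so \<open>n\<close> rounds
  with \<open>C \<le> real n * e\<close> are enough; enumerating the resulting infinite set gives
  the subsequence.\<close>

lemma rosenthal_disjointification:
  fixes m :: "nat \<Rightarrow> nat \<Rightarrow> real"
  assumes pos: "\<And>k j. 0 \<le> m k j" and e: "0 < e" and C: "\<And>k J. finite J \<Longrightarrow> sum (m k) J \<le> C"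
  obtains r where "strict_mono (r :: nat \<Rightarrow> nat)"
    "\<forall>k J. finite J \<longrightarrow> k \<notin> J \<longrightarrow> (\<Sum>j\<in>J. m (r k) (r j)) \<le> e"
proof -
  obtain n where n: "C / e \<le> real n" using real_arch_simple by blast
  then have "C \<le> real n * e" using e by (simp add: field_simps)
  then have "sum (m k) J \<le> real n * e" if "finite J" for k J using C[OF that, of k] by simp
  then obtain N where N: "infinite N" "\<forall>k\<in>N. \<forall>J. finite J \<longrightarrow> J \<subseteq> N - {k} \<longrightarrow> sum (m k) J \<le> e"
    using rosenthal_aux[of m e UNIV n, OF pos e] by auto
  define r where "r = enumerate N"
  have r: "strict_mono r" unfolding r_def by (rule strict_mono_enumerate[OF N(1)])
  then have inj: "inj r" by (rule strict_mono_imp_inj_on)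
  have rN: "r k \<in> N" for k unfolding r_def by (rule enumerate_in_set[OF N(1)])
  have "(\<Sum>j\<in>J. m (r k) (r j)) \<le> e" if J: "finite J" "k \<notin> J" for k J
  proof -
    have "(\<Sum>j\<in>J. m (r k) (r j)) = sum (m (r k)) (r ` J)"
      by (subst sum.reindex) (use inj in \<open>auto intro: inj_on_subset\<close>)
    also have "r ` J \<subseteq> N - {r k}" using rN J(2) injD[OF inj] by auto
    then have "sum (m (r k)) (r ` J) \<le> e" using N(2) rN J(1) by blast
    finally show ?thesis .
  qed
  then show ?thesis using that[OF r] by blast
qed

section \<open>The spaces \<open>M\<close> and \<open>M0\<close> of an operator family\<close>

locale operator_family =
  fixes scaleX :: "'k::real_or_complex \<Rightarrow> 'x::banach \<Rightarrow> 'x"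
    and scaleY :: "'k \<Rightarrow> 'y::banach \<Rightarrow> 'y"
    and \<L> :: "('x \<Rightarrow>\<^sub>L 'y) set"
    and \<tau> :: "('x \<Rightarrow>\<^sub>L 'y) topology"
    and C :: real
  assumes scaleX: "banach_space scaleX" and scaleY: "banach_space scaleY"
    and lin: "\<And>L c x. L \<in> \<L> \<Longrightarrow> blinfun_apply L (scaleX c x) = scaleY c (blinfun_apply L x)"
    and top: "topspace \<tau> = \<L>"
    and cont: "\<And>x. continuous_map \<tau> euclidean (\<lambda>L. blinfun_apply L x)"
    and M_banach: "banach_space_on scaleX (M_space \<L>) (M_norm \<L>)"
    and C: "0 < C" "\<And>x. x \<in> M_space \<L> \<Longrightarrow> norm x \<le> C * M_norm \<L> x"
begin

abbreviation "M \<equiv> M_space \<L>"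
abbreviation "M0 \<equiv> M0_space \<L> \<tau>"
abbreviation "N \<equiv> M_norm \<L>"

lemma N_nonneg: "0 \<le> N x"
  by (simp add: M_norm_def)

lemma norm_apply_le_N:
  assumes "x \<in> M" "L \<in> \<L>" shows "norm (blinfun_apply L x) \<le> N x"
proof -
  have "ennreal (norm (blinfun_apply L x)) \<le> sup_norm \<L> x"
    unfolding sup_norm_def by (rule SUP_upper[OF assms(2)])
  moreover have "sup_norm \<L> x = ennreal (N x)"
    using assms(1) by (simp add: M_norm_def M_space_def less_top)
  ultimately show ?thesis using N_nonneg by (simp add: ennreal_le_iff)
qed

lemma sup_norm_le:
  assumes "\<And>L. L \<in> S \<Longrightarrow> norm (blinfun_apply L x) \<le> B"
  shows "sup_norm S x \<le> ennreal B"
  unfolding sup_norm_def by (rule SUP_least) (simp add: assms ennreal_leI)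

lemma M_I:
  assumes "0 \<le> B" "\<And>L. L \<in> \<L> \<Longrightarrow> norm (blinfun_apply L x) \<le> B"
  shows "x \<in> M" "N x \<le> B"
proof -
  have le: "sup_norm \<L> x \<le> ennreal B" by (rule sup_norm_le[OF assms(2)])
  then show "x \<in> M" unfolding M_space_def
    using ennreal_less_top[of B] by (simp add: order_le_less_trans)
  show "N x \<le> B" unfolding M_norm_def
    using enn2real_mono[OF le] assms(1) by simp
qed

lemma M0_subset_M: "M0 \<subseteq> M"
  by (auto simp: M0_space_def)

lemma M0_D:
  assumes "x \<in> M0" "0 < e"
  obtains K where "compactin \<tau> K" "\<forall>L\<in>\<L> - K. norm (blinfun_apply L x) \<le> e"
proof -
  have "limsup_infinity \<L> \<tau> x < ennreal e" using assms by (simp add: M0_space_def)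
  then obtain K where K: "compactin \<tau> K" "sup_norm (\<L> - K) x < ennreal e"
    unfolding limsup_infinity_def INF_less_iff by blast
  have "norm (blinfun_apply L x) \<le> e" if "L \<in> \<L> - K" for L
  proof -
    have "ennreal (norm (blinfun_apply L x)) \<le> sup_norm (\<L> - K) x"
      unfolding sup_norm_def by (rule SUP_upper[OF that])
    then have "ennreal (norm (blinfun_apply L x)) \<le> ennreal e" using K(2) by simp
    then show ?thesis using assms(2) by (simp add: ennreal_le_iff)
  qed
  then show ?thesis using that K(1) by blast
qed

lemma M0_I:
  assumes "x \<in> M"
    and "\<And>e. 0 < e \<Longrightarrow> \<exists>K. compactin \<tau> K \<and> (\<forall>L\<in>\<L> - K. norm (blinfun_apply L x) \<le> e)"
  shows "x \<in> M0"
proof -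
  have "limsup_infinity \<L> \<tau> x \<le> 0"
  proof (rule ennreal_le_epsilon)
    fix e :: real assume e: "0 < e"
    obtain K where K: "compactin \<tau> K" "\<forall>L\<in>\<L> - K. norm (blinfun_apply L x) \<le> e"
      using assms(2)[OF e] by blast
    have "limsup_infinity \<L> \<tau> x \<le> sup_norm (\<L> - K) x"
      unfolding limsup_infinity_def by (rule INF_lower) (simp add: K)
    also have "\<dots> \<le> ennreal e" by (rule sup_norm_le) (use K(2) in blast)
    finally show "limsup_infinity \<L> \<tau> x \<le> 0 + ennreal e" by simp
  qed
  then show ?thesis using assms(1) by (simp add: M0_space_def)
qed

lemma normed_space_on_M: "normed_space_on scaleX M N"
proof -
  have "N (- x) = N x" for x by (simp add: M_norm_def sup_norm_def blinfun.minus_right)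
  then show ?thesis
    using M_banach banach_spaceD(2)[OF scaleX] N_nonneg
    by (simp add: banach_space_on_def normed_space_on_def)
qed

lemma normed_space_on_M0: "normed_space_on scaleX M0 N"
proof (rule normed_space_on_subspace[OF normed_space_on_M _ M0_subset_M])
  note M_D = normed_space_onD[OF normed_space_on_M]
  have "0 \<in> M0" by (rule M0_I[OF M_D(3)]) (use compactin_empty in \<open>auto intro: exI[of _ "{}"]\<close>)
  moreover have "x + y \<in> M0" if xy: "x \<in> M0" "y \<in> M0" for x y
  proof (rule M0_I)
    show "x + y \<in> M" using xy M_D(4) M0_subset_M by blast
    fix e :: real assume "0 < e"
    then have e: "0 < e / 2" by simp
    obtain K where K: "compactin \<tau> K" "\<forall>L\<in>\<L> - K. norm (blinfun_apply L x) \<le> e / 2"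
      by (rule M0_D[OF xy(1) e])
    obtain K' where K': "compactin \<tau> K'" "\<forall>L\<in>\<L> - K'. norm (blinfun_apply L y) \<le> e / 2"
      by (rule M0_D[OF xy(2) e])
    have "norm (blinfun_apply L (x + y)) \<le> e" if "L \<in> \<L> - (K \<union> K')" for L
    proof -
      have "norm (blinfun_apply L x) \<le> e / 2" "norm (blinfun_apply L y) \<le> e / 2"
        using that K(2) K'(2) by auto
      then show ?thesis
        using norm_triangle_ineq[of "blinfun_apply L x" "blinfun_apply L y"]
        by (simp add: blinfun.add_right)
    qed
    then show "\<exists>K. compactin \<tau> K \<and> (\<forall>L\<in>\<L> - K. norm (blinfun_apply L (x + y)) \<le> e)"
      using compactin_Un[OF K(1) K'(1)] by blast
  qed
  moreover have "scaleX c x \<in> M0" if x: "x \<in> M0" for c x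
  proof (rule M0_I)
    show "scaleX c x \<in> M" using x M_D(6) M0_subset_M by blast
    fix e :: real assume e: "0 < e"
    then have "0 < e / (norm c + 1)" by (simp add: add_nonneg_pos)
    from M0_D[OF x this] obtain K where K: "compactin \<tau> K"
      "\<forall>L\<in>\<L> - K. norm (blinfun_apply L x) \<le> e / (norm c + 1)" by metis
    have "norm (blinfun_apply L (scaleX c x)) \<le> e" if L: "L \<in> \<L> - K" for L
    proof -
      have "norm (blinfun_apply L (scaleX c x)) = norm c * norm (blinfun_apply L x)"
        using L by (simp add: lin banach_spaceD(4)[OF scaleY])
      also have "\<dots> \<le> (norm c + 1) * (e / (norm c + 1))"
        using K(2) L by (intro mult_mono) auto
      also have "\<dots> = e" by (simp add: add_nonneg_eq_0_iff)
      finally show ?thesis .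
    qed
    then show "\<exists>K. compactin \<tau> K \<and> (\<forall>L\<in>\<L> - K. norm (blinfun_apply L (scaleX c x)) \<le> e)"
      using K(1) by blast
  qed
  ultimately show "module.subspace scaleX M0"
    by (simp add: module.subspace_def[OF banach_spaceD(2)[OF scaleX]])
qed

text \<open>\<open>\<tau>\<close> is only known to make the maps \<open>L \<mapsto> L x\<close>
  continuous. Compactness bounds each of these on \<open>K\<close>, and uniform boundedness turns
  this into one operator bound, through which vectors small in \<open>X\<close> become uniformly
  small on \<open>K\<close>.\<close>

lemma equibounded_on_compact:
  assumes K: "compactin \<tau> K"
  obtains D where "0 < D" "\<forall>L\<in>K. \<forall>x. norm (blinfun_apply L x) \<le> D * norm x"
proof -
  have "\<exists>B. \<forall>L\<in>K. norm (blinfun_apply L x) \<le> B" for x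
  proof -
    have "compact ((\<lambda>L. blinfun_apply L x) ` K)"
      using image_compactin[OF K cont] by simp
    from compact_imp_bounded[OF this] show ?thesis by (auto simp: bounded_iff)
  qed
  then obtain D where D: "\<forall>L\<in>K. norm L \<le> D" using uniform_boundedness by blast
  have "norm (blinfun_apply L x) \<le> max D 1 * norm x" if "L \<in> K" for L x
  proof -
    have "norm (blinfun_apply L x) \<le> norm L * norm x" by (rule norm_blinfun)
    also have "\<dots> \<le> max D 1 * norm x" using D that by (intro mult_right_mono) (auto simp: le_max_iff_disj)
    finally show ?thesis .
  qed
  then show ?thesis using that[of "max D 1"] by simp
qed

text \<open>Gliding hump: every \<open>L\<close> is large on at most one member of the sequence.\<close>

lemma gliding_hump:
  assumes P: "\<And>d. 0 < d \<Longrightarrow> \<exists>y\<in>M0. N y \<le> 1 \<and> norm y < d \<and> P y"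
  obtains y where "\<forall>n. y n \<in> M0" "\<forall>n. norm (y n) \<le> (1/2) ^ n" "\<forall>n. P (y n)"
    "\<forall>L\<in>\<L>. \<forall>J. finite J \<longrightarrow> (\<Sum>n\<in>J. norm (blinfun_apply L (y n))) \<le> 3"
proof -
  \<comment> \<open>A state is a compact set with a vector small on it. By \<open>nxt\<close> the
    following compact set is larger, and the vector is small outside that one as well.\<close>
  define good where "good n p \<longleftrightarrow> compactin \<tau> (fst p) \<and> snd p \<in> M0 \<and> N (snd p) \<le> 1 \<and>
    norm (snd p) \<le> (1/2) ^ n \<and> P (snd p) \<and>
    (\<forall>L\<in>fst p. norm (blinfun_apply L (snd p)) \<le> (1/2) ^ n)" for n :: nat and p
  define nxt where "nxt n p q \<longleftrightarrow> fst p \<subseteq> fst q \<and>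
    (\<forall>L\<in>\<L> - fst q. norm (blinfun_apply L (snd p)) \<le> (1/2) ^ n)"
    for n :: nat and p q :: "('x \<Rightarrow>\<^sub>L 'y) set \<times> 'x"
  have ex: "\<exists>y. good n (K, y)" if K: "compactin \<tau> K" for n K
  proof -
    obtain D where D: "0 < D" "\<forall>L\<in>K. \<forall>x. norm (blinfun_apply L x) \<le> D * norm x"
      by (rule equibounded_on_compact[OF K])
    \<comment> \<open>The first bound gives summability in \<open>X\<close>, the second smallness on
      \<open>K\<close> through the operator bound \<open>D\<close>.\<close>
    have "0 < min ((1/2) ^ n) ((1/2) ^ n / D)" using D(1) by simp
    from P[OF this] obtain y where y: "y \<in> M0" "N y \<le> 1" "norm y < (1/2) ^ n"
      "norm y < (1/2) ^ n / D" "P y" by auto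
    have "norm (blinfun_apply L y) \<le> (1/2) ^ n" if "L \<in> K" for L
    proof -
      have "norm (blinfun_apply L y) \<le> D * norm y" using D(2) that by blast
      also have "\<dots> \<le> D * ((1/2) ^ n / D)" using y(4) D(1) by (intro mult_left_mono) auto
      also have "\<dots> = (1/2) ^ n" using D(1) by simp
      finally show ?thesis .
    qed
    then show ?thesis using K y by (intro exI[of _ y]) (simp add: good_def)
  qed
  have "\<exists>p. \<forall>n. good n (p n) \<and> nxt n (p n) (p (Suc n))"
  proof (rule dependent_nat_choice)
    show "\<exists>p. good 0 p" using ex[OF compactin_empty] by blast
    fix p n assume p: "good n p"
    then have "snd p \<in> M0" "0 < (1/2::real) ^ n" by (auto simp: good_def)
    then obtain K where K: "compactin \<tau> K" "\<forall>L\<in>\<L> - K. norm (blinfun_apply L (snd p)) \<le> (1/2) ^ n"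
      by (rule M0_D)
    have "compactin \<tau> (fst p \<union> K)" using p K(1) by (simp add: good_def compactin_Un)
    from ex[OF this] obtain y where "good (Suc n) (fst p \<union> K, y)" by (rule exE)
    moreover have "nxt n p (fst p \<union> K, y)" using K(2) by (auto simp: nxt_def)
    ultimately show "\<exists>q. good (Suc n) q \<and> nxt n p q" by blast
  qed
  then obtain p where p: "\<forall>n. good n (p n)" "\<forall>n. nxt n (p n) (p (Suc n))" by blast
  define y where "y n = snd (p n)" for n
  define K where "K n = fst (p n)" for n
  have y: "y n \<in> M0" "N (y n) \<le> 1" "norm (y n) \<le> (1/2) ^ n" "P (y n)"
    "L \<in> K n \<Longrightarrow> norm (blinfun_apply L (y n)) \<le> (1/2) ^ n" for n L
    using p(1) by (auto simp: good_def y_def K_def)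
  have K: "K n \<subseteq> K (Suc n)" "L \<in> \<L> \<Longrightarrow> L \<notin> K (Suc n) \<Longrightarrow> norm (blinfun_apply L (y n)) \<le> (1/2) ^ n" for n L
    using p(2) by (auto simp: nxt_def y_def K_def)
  \<comment> \<open>The indicator pays for the one large term, at most 1 because
    \<open>N (y n) \<le> 1\<close>, in the step where \<open>L\<close> enters the increasing sets
    \<open>K n\<close>. With the geometric sum 2 this gives the constant 3.\<close>
  have partial: "(\<Sum>k<n. norm (blinfun_apply L (y k))) \<le> (\<Sum>k<n. (1/2) ^ k) + (if L \<in> K n then 1 else 0)"
    if L: "L \<in> \<L>" for L n
  proof (induction n)
    case (Suc n)
    have "norm (blinfun_apply L (y n)) + (if L \<in> K n then 1 else 0)
        \<le> (1/2) ^ n + (if L \<in> K (Suc n) then 1 else 0)"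
    proof (cases "L \<in> K n")
      case True
      then show ?thesis using K(1)[of n] y(5)[of L n] by auto
    next
      case False
      have "norm (blinfun_apply L (y n)) \<le> 1"
        using norm_apply_le_N[OF subsetD[OF M0_subset_M y(1)] L, of n] y(2)[of n] by linarith
      moreover have "0 \<le> (1/2::real) ^ n" by simp
      ultimately have "norm (blinfun_apply L (y n)) \<le> (1/2) ^ n + 1" by linarith
      then show ?thesis using False K(2)[OF L, of n] by simp
    qed
    then show ?case using Suc by simp
  qed simp
  have "(\<Sum>n\<in>J. norm (blinfun_apply L (y n))) \<le> 3" if L: "L \<in> \<L>" and J: "finite J" for L J
  proof -
    obtain n where n: "J \<subseteq> {..<n}" using finite_nat_iff_bounded J by blast
    have "(\<Sum>k\<in>J. norm (blinfun_apply L (y k))) \<le> (\<Sum>k<n. norm (blinfun_apply L (y k)))"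
      by (rule sum_mono2) (use n in auto)
    also have "\<dots> \<le> (\<Sum>k<n. (1/2) ^ k) + (if L \<in> K n then 1 else 0)" by (rule partial[OF L])
    also have "(\<Sum>k<n. (1/2::real) ^ k) \<le> (\<Sum>k. (1/2) ^ k)"
      by (rule sum_le_suminf) (auto simp: summable_geometric)
    also have "(\<Sum>k. (1/2::real) ^ k) = 2" by (simp add: suminf_geometric)
    finally show ?thesis by (auto split: if_splits)
  qed
  then show ?thesis using that[of y] y(1,3,4) by blast
qed

end

section \<open>Series with coefficients in \<open>c0\<close>\<close>

lemma subspace_combination:
  assumes A: "normed_space_on smul A N" and y: "\<And>j. y j \<in> A" and J: "finite J"
  shows "(\<Sum>j\<in>J. smul (c j) (y j)) \<in> A"
  using J by induction (simp_all add: normed_space_onD[OF A] y)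

lemma linear_on_combination:
  fixes T :: "'a::ab_group_add \<Rightarrow> 'b::ab_group_add"
  assumes A: "normed_space_on smul A N" and T: "linear_on smul smul' A T"
    and y: "\<And>j. y j \<in> A" and J: "finite J"
  shows "T (\<Sum>j\<in>J. smul (c j) (y j)) = (\<Sum>j\<in>J. smul' (c j) (T (y j)))"
  using J
proof induction
  case (insert i J)
  then show ?case
    using T y normed_space_onD(6)[OF A y] subspace_combination[OF A y insert(1)]
    by (simp add: linear_on_def)
qed (simp add: linear_on_zero[OF A T])

lemma dual_combination:
  assumes "h \<in> dual smul" and "finite J"
  shows "h (\<Sum>j\<in>J. smul (c j) (y j)) = (\<Sum>j\<in>J. c j * h (y j))"
  using assms(2) by induction (simp_all add: dualD[OF assms(1)])

lemma bounded_linear_banach_scale: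
  assumes smul: "banach_space smul" shows "bounded_linear (smul c)"
proof (rule bounded_linear_intro[where K = "norm c"])
  note md = banach_spaceD(2)[OF smul]
  show "smul c (x + y) = smul c x + smul c y" for x y by (rule module.scale_right_distrib[OF md])
  show "smul c (r *\<^sub>R x) = r *\<^sub>R smul c x" for r x
    using module.scale_scale[OF md, of c "of_real r" x] module.scale_scale[OF md, of "of_real r" c x]
    by (simp add: banach_spaceD(3)[OF smul] mult.commute)
  show "norm (smul c x) \<le> norm x * norm c" for x
    by (simp add: banach_spaceD(4)[OF smul] mult.commute)
qed

context operator_family
begin

text \<open>Bounded absolute sums let only the largest coefficient enter: the estimate of a weakly
  unconditionally Cauchy series, tested on the operators \<open>L\<close>.\<close>

lemma combination_bound:
  assumes y: "\<And>n. y n \<in> M0"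
    and D: "\<And>L J. L \<in> \<L> \<Longrightarrow> finite J \<Longrightarrow> (\<Sum>n\<in>J. norm (blinfun_apply L (y n))) \<le> D"
    and J: "finite J" and s: "0 \<le> s" "\<And>j. j \<in> J \<Longrightarrow> norm (c j) \<le> s" and L: "L \<in> \<L>"
  shows "norm (blinfun_apply L (\<Sum>j\<in>J. scaleX (c j) (y j))) \<le> s * D"
proof -
  have "norm (blinfun_apply L (\<Sum>j\<in>J. scaleX (c j) (y j)))
      = norm (\<Sum>j\<in>J. scaleY (c j) (blinfun_apply L (y j)))"
    by (simp add: blinfun.sum_right lin[OF L])
  also have "\<dots> \<le> (\<Sum>j\<in>J. norm (c j) * norm (blinfun_apply L (y j)))"
    by (rule order_trans[OF norm_sum]) (simp add: banach_spaceD(4)[OF scaleY])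
  also have "\<dots> \<le> (\<Sum>j\<in>J. s * norm (blinfun_apply L (y j)))"
    by (intro sum_mono mult_right_mono s(2)) auto
  also have "\<dots> = s * (\<Sum>j\<in>J. norm (blinfun_apply L (y j)))" by (simp add: sum_distrib_left)
  also have "\<dots> \<le> s * D" by (intro mult_left_mono D L J s(1))
  finally show ?thesis .
qed

text \<open>The map \<open>U\<close> has an upper bound from \<open>D\<close> and, through
  \<open>T\<close>, a lower bound from the functionals: \<open>h k\<close> sees coefficient
  \<open>k\<close> with weight at least \<open>e\<close> and all the others together with weight at
  most \<open>e / 2\<close>. Hence both \<open>U\<close> and \<open>T\<close> on its range are
  bounded below.\<close>

lemma c0_copy:
  fixes scaleZ :: "'k \<Rightarrow> 'z::banach \<Rightarrow> 'z"
  assumes scaleZ: "banach_space scaleZ" and T: "bounded_linear_on scaleX scaleZ M0 N T"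
    and y: "\<And>n. y n \<in> M0" "\<And>n. norm (y n) \<le> (1/2) ^ n"
    and D: "0 \<le> D" "\<And>L J. L \<in> \<L> \<Longrightarrow> finite J \<Longrightarrow> (\<Sum>n\<in>J. norm (blinfun_apply L (y n))) \<le> D"
    and h: "\<And>k. h k \<in> dual scaleZ" "\<And>k z. norm (h k z) \<le> norm z"
    and e: "0 < e" "\<And>k. e \<le> norm (h k (T (y k)))"
    and off: "\<And>k J. finite J \<Longrightarrow> k \<notin> J \<Longrightarrow> (\<Sum>j\<in>J. norm (h k (T (y j)))) \<le> e / 2"
  shows "\<exists>F. module.subspace scaleX F \<and> F \<subseteq> M0 \<and>
    (\<exists>S. linear_homeomorphism_on scaleX scale_seq F N c0 norm S) \<and>
    linear_homeomorphism_on scaleX scaleZ F N (T ` F) norm T"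
proof -
  note mX = banach_spaceD(2)[OF scaleX]
  note M0_D' = normed_space_onD[OF normed_space_on_M0]
  note c0_D = normed_space_onD[OF normed_space_on_c0[where 'a = 'k]]
  have Tlin: "linear_on scaleX scaleZ M0 T" using T by (simp add: bounded_linear_on_def)
  obtain K0 where K0: "\<And>x. x \<in> M0 \<Longrightarrow> norm (T x) \<le> K0 * N x"
    using T unfolding bounded_linear_on_def by blast
  define K where "K = \<bar>K0\<bar> + 1"
  have K_pos: "K > 0" by (simp add: K_def)
  have K: "norm (T x) \<le> K * N x" if "x \<in> M0" for x
  proof -
    have "K0 * N x \<le> K * N x" using N_nonneg[of x] by (intro mult_right_mono) (auto simp: K_def)
    then show ?thesis using K0[OF that] by linarith
  qed
  define U where "U a = (\<Sum>n. scaleX (apply_bcontfun a n) (y n))" for a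
  define part where "part a n = (\<Sum>j<n. scaleX (apply_bcontfun a j) (y j))" for a n
  \<comment> \<open>Geometric decay gives absolute convergence in \<open>X\<close> for every bounded
    sequence; convergence for \<open>N\<close> is a separate matter.\<close>
  have summable: "summable (\<lambda>n. scaleX (apply_bcontfun a n) (y n))" for a
  proof (rule summable_comparison_test'[where N = 0])
    show "summable (\<lambda>n. norm a * (1/2::real) ^ n)"
      by (intro summable_mult summable_geometric) simp
    show "norm (scaleX (apply_bcontfun a n) (y n)) \<le> norm a * (1/2) ^ n" for n
      unfolding banach_spaceD(4)[OF scaleX] by (intro mult_mono norm_bounded y) auto
  qed
  have part_lim: "part a \<longlonglongrightarrow> U a" for a
    unfolding part_def U_def by (rule summable_LIMSEQ[OF summable])
  have part_M0: "part a n \<in> M0" for a n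
    unfolding part_def by (rule subspace_combination[OF normed_space_on_M0 y(1)]) simp
  \<comment> \<open>Each \<open>L\<close> is continuous on \<open>X\<close>, so the bound for finite
    blocks survives the limit. With \<open>n0 = 0\<close> it bounds \<open>N (U a)\<close>; for
    coefficients tending to 0 it gives convergence for \<open>N\<close>.\<close>
  have tail: "norm (blinfun_apply L (U a - part a n0)) \<le> s * D"
    if L: "L \<in> \<L>" and s: "0 \<le> s" "\<And>j. j \<ge> n0 \<Longrightarrow> norm (apply_bcontfun a j) \<le> s" for L a n0 s
  proof (rule LIMSEQ_le_const2)
    show "(\<lambda>n. norm (blinfun_apply L (part a n - part a n0))) \<longlonglongrightarrow> norm (blinfun_apply L (U a - part a n0))"
      by (intro tendsto_intros part_lim)
    have "norm (blinfun_apply L (part a n - part a n0)) \<le> s * D" if "n \<ge> n0" for n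
    proof -
      have "part a n - part a n0 = (\<Sum>j\<in>{..<n} - {..<n0}. scaleX (apply_bcontfun a j) (y j))"
        unfolding part_def using that by (subst sum_diff) auto
      then show ?thesis using combination_bound[OF y(1) D(2), of "{..<n} - {..<n0}" s] s L by simp
    qed
    then show "\<exists>N. \<forall>n\<ge>N. norm (blinfun_apply L (part a n - part a n0)) \<le> s * D" by blast
  qed
  have c0_small: "\<exists>n0. \<forall>j\<ge>n0. norm (apply_bcontfun a j) \<le> s" if "a \<in> c0" "0 < s" for s a
  proof -
    have "apply_bcontfun a \<longlonglongrightarrow> 0" using that(1) by (simp add: c0_def)
    from LIMSEQ_D[OF this that(2)] show ?thesis by (auto intro: less_imp_le)
  qed
  have part0: "part a 0 = 0" for a by (simp add: part_def)
  have U_M: "U a \<in> M" "N (U a) \<le> norm a * D" for a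
    using M_I[of "norm a * D" "U a"] tail[of _ "norm a" 0 a] D(1) norm_bounded[of a] by (auto simp: part0)
  \<comment> \<open>A partial sum is small off a compact set, and the remainder is small uniformly
    over all \<open>L\<close>.\<close>
  have U_M0: "U a \<in> M0" if a: "a \<in> c0" for a
  proof (rule M0_I[OF U_M(1)])
    fix d :: real assume d: "0 < d"
    define s where "s = d / (2 * (D + 1))"
    have s: "0 < s" "s * D \<le> d / 2" using d D(1) by (auto simp: s_def field_simps)
    obtain n0 where n0: "\<forall>j\<ge>n0. norm (apply_bcontfun a j) \<le> s" using c0_small[OF a s(1)] by blast
    obtain K where K: "compactin \<tau> K" "\<forall>L\<in>\<L> - K. norm (blinfun_apply L (part a n0)) \<le> d / 2"
      by (rule M0_D[OF part_M0, of "d / 2"]) (use d in auto)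
    have "norm (blinfun_apply L (U a)) \<le> d" if L: "L \<in> \<L> - K" for L
    proof -
      have "norm (blinfun_apply L (U a - part a n0)) \<le> s * D"
        using L s(1) n0 by (intro tail) auto
      moreover have "norm (blinfun_apply L (part a n0)) \<le> d / 2" using K(2) L by blast
      moreover have "norm (blinfun_apply L (U a))
          \<le> norm (blinfun_apply L (U a - part a n0)) + norm (blinfun_apply L (part a n0))"
        using norm_triangle_ineq[of "blinfun_apply L (U a - part a n0)" "blinfun_apply L (part a n0)"]
        by (simp add: blinfun.diff_right)
      ultimately show ?thesis using s(2) by linarith
    qed
    then show "\<exists>K. compactin \<tau> K \<and> (\<forall>L\<in>\<L> - K. norm (blinfun_apply L (U a)) \<le> d)" using K(1) by blast
  qed
  \<comment> \<open>\<open>T\<close> is bounded for \<open>N\<close> only, so convergence of the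
    partial sums in \<open>X\<close> would not be enough here.\<close>
  have T_lim: "(\<lambda>n. T (part a n)) \<longlonglongrightarrow> T (U a)" if a: "a \<in> c0" for a
  proof (rule LIMSEQ_I)
    fix d :: real assume d: "0 < d"
    define b where "b = K * (D + 1)"
    define s where "s = d / (2 * b)"
    have b: "b > 0" using D(1) K_pos by (simp add: b_def)
    have s: "0 < s" "K * (s * D) < d"
    proof -
      show "0 < s" using d b by (simp add: s_def)
      then have "K * (s * D) \<le> K * (s * (D + 1))" using K_pos by (intro mult_left_mono) auto
      also have "\<dots> = s * b" by (simp add: b_def)
      also have "\<dots> = d / 2" using b by (simp add: s_def)
      finally show "K * (s * D) < d" using d by linarith
    qed
    obtain n0 where n0: "\<forall>j\<ge>n0. norm (apply_bcontfun a j) \<le> s" using c0_small[OF a s(1)] by blast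
    have "norm (T (part a n) - T (U a)) < d" if n: "n \<ge> n0" for n
    proof -
      have "N (U a - part a n) \<le> s * D"
        by (rule M_I(2)) (use s(1) D(1) n0 n in \<open>auto intro!: tail\<close>)
      then have "K * N (U a - part a n) \<le> K * (s * D)" using K_pos by (intro mult_left_mono) auto
      moreover have "norm (T (part a n) - T (U a)) = norm (T (U a - part a n))"
        by (simp add: linear_on_diff[OF normed_space_on_M0 Tlin U_M0[OF a] part_M0] norm_minus_commute)
      moreover have "norm (T (U a - part a n)) \<le> K * N (U a - part a n)"
        by (rule K[OF M0_D'(5)[OF U_M0[OF a] part_M0]])
      ultimately show ?thesis using s(2) by linarith
    qed
    then show "\<exists>no. \<forall>n\<ge>no. norm (T (part a n) - T (U a)) < d" by blast
  qed
  have coord: "norm (apply_bcontfun a k) * e \<le> norm (T (U a)) + e / 2 * norm a" if a: "a \<in> c0" for a k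
  proof -
    have "(\<lambda>n. norm (h k (T (part a n)))) \<longlonglongrightarrow> norm (h k (T (U a)))"
      by (intro tendsto_norm bounded_linear.tendsto[OF dualD(6)[OF h(1)]] T_lim a)
    moreover have "norm (apply_bcontfun a k) * e - e / 2 * norm a \<le> norm (h k (T (part a n)))"
      if n: "n \<ge> Suc k" for n
    proof -
      let ?t = "\<lambda>j. apply_bcontfun a j * h k (T (y j))" and ?J = "{..<n} - {k}"
      have "T (part a n) = (\<Sum>j<n. scaleZ (apply_bcontfun a j) (T (y j)))"
        unfolding part_def by (rule linear_on_combination[OF normed_space_on_M0 Tlin y(1)]) simp
      then have "h k (T (part a n)) = (\<Sum>j<n. ?t j)" by (simp add: dual_combination[OF h(1)])
      also have "\<dots> = ?t k + (\<Sum>j\<in>?J. ?t j)" using n by (intro sum.remove) auto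
      finally have "norm (?t k) - norm (\<Sum>j\<in>?J. ?t j) \<le> norm (h k (T (part a n)))"
        by (metis norm_diff_ineq)
      moreover have "norm (\<Sum>j\<in>?J. ?t j) \<le> (\<Sum>j\<in>?J. norm a * norm (h k (T (y j))))"
        by (rule sum_norm_le) (simp add: norm_mult mult_right_mono norm_bounded)
      moreover have "\<dots> \<le> norm a * (e / 2)"
        unfolding sum_distrib_left[symmetric] by (intro mult_left_mono off) auto
      moreover have "norm (apply_bcontfun a k) * e \<le> norm (?t k)"
        unfolding norm_mult by (intro mult_left_mono e(2)) simp
      ultimately show ?thesis by (simp add: mult.commute)
    qed
    ultimately have "norm (apply_bcontfun a k) * e - e / 2 * norm a \<le> norm (h k (T (U a)))"
      by (intro LIMSEQ_le_const) auto
    then show ?thesis using h(2)[of k "T (U a)"] by linarith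
  qed
  have low: "e / 2 * norm a \<le> norm (T (U a))" if a: "a \<in> c0" for a
  proof -
    \<comment> \<open>The supremum over all coordinates gives
      \<open>e * norm a \<le> norm (T (U a)) + e / 2 * norm a\<close>, and the last term is
      absorbed.\<close>
    have "norm a \<le> (norm (T (U a)) + e / 2 * norm a) / e"
      by (rule norm_bound) (use coord[OF a] e(1) in \<open>simp add: pos_le_divide_eq\<close>)
    then show ?thesis using e(1) by (simp add: field_simps)
  qed
  have Uadd: "U (a + b) = U a + U b" for a b
    unfolding U_def
    by (simp add: module.scale_left_distrib[OF mX] plus_bcontfun.rep_eq suminf_add[OF summable summable])
  have Uscale: "U (scale_seq c a) = scaleX c (U a)" for c a
    unfolding U_def bounded_linear.suminf[OF bounded_linear_banach_scale[OF scaleX] summable]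
    by (simp add: apply_scale_seq module.scale_scale[OF mX])
  have Ulin: "linear_on scale_seq scaleX c0 U" using Uadd Uscale by (simp add: linear_on_def)
  define F where "F = U ` c0"
  have sF: "module.subspace scaleX F"
    unfolding F_def by (rule linear_on_image_subspace[OF normed_space_on_c0 mX Ulin])
  have FM: "F \<subseteq> M0" using U_M0 by (auto simp: F_def)
  have nF: "normed_space_on scaleX F N" by (rule normed_space_on_subspace[OF normed_space_on_M0 sF FM])
  have TF: "linear_on scaleX scaleZ F T" using Tlin FM by (simp add: linear_on_def subset_iff)
  have nT: "normed_space_on scaleZ (T ` F) norm"
    by (rule normed_space_on_banach_space[OF scaleZ linear_on_image_subspace[OF nF banach_spaceD(2)[OF scaleZ] TF]])
  have "linear_homeomorphism_on scaleX scale_seq F N c0 norm (inv_into c0 U)"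
    unfolding F_def
  proof (rule linear_homeomorphism_onI(2)[OF normed_space_on_c0 nF[unfolded F_def] Ulin, where C = D and c = "e / 2 / K"])
    show "0 < e / 2 / K" using e(1) K_pos by simp
    show "N (U a) \<le> D * norm a" for a using U_M(2)[of a] by (simp add: mult.commute)
    show "e / 2 / K * norm a \<le> N (U a)" if "a \<in> c0" for a
      using low[OF that] K[OF U_M0[OF that]] K_pos by (simp add: field_simps)
  qed
  moreover have "linear_homeomorphism_on scaleX scaleZ F N (T ` F) norm T"
  \<comment> \<open>\<open>D\<close> may be 0, so \<open>D + 1\<close> is used as the
    divisor.\<close>
  proof (rule linear_homeomorphism_onI(1)[OF nF nT TF, where C = K and c = "e / 2 / (D + 1)"])
    show "0 < e / 2 / (D + 1)" using e(1) D(1) by simp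
    show "norm (T x) \<le> K * N x" if "x \<in> F" for x using K that FM by blast
    show "e / 2 / (D + 1) * N x \<le> norm (T x)" if x: "x \<in> F" for x
    proof -
      obtain a where a: "a \<in> c0" "x = U a" using x by (auto simp: F_def)
      have "norm a * D \<le> norm a * (D + 1)" by (intro mult_left_mono) auto
      then have "N x \<le> norm a * (D + 1)" using U_M(2)[of a] unfolding a(2) by linarith
      then have "e / 2 / (D + 1) * N x \<le> e / 2 / (D + 1) * (norm a * (D + 1))"
        using e(1) D(1) by (intro mult_left_mono) auto
      also have "\<dots> = e / 2 / (D + 1) * (D + 1) * norm a" by (simp only: mult_ac)
      also have "e / 2 / (D + 1) * (D + 1) = e / 2"
        by (rule nonzero_eq_divide_eq[THEN iffD1, OF _ refl]) (use D(1) in linarith)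
      also have "e / 2 * norm a \<le> norm (T x)" unfolding a(2) by (rule low[OF a(1)])
      finally show ?thesis .
    qed
  qed
  ultimately show ?thesis using sF FM by blast
qed

theorem fixes_c0_if_discontinuous_on_ball:
  fixes scaleZ :: "'k \<Rightarrow> 'z::banach \<Rightarrow> 'z"
  assumes scaleZ: "banach_space scaleZ" and T: "bounded_linear_on scaleX scaleZ M0 N T"
    and e: "0 < e" and P: "\<And>d. 0 < d \<Longrightarrow> \<exists>y\<in>M0. N y \<le> 1 \<and> norm y < d \<and> e < norm (T y)"
  shows "\<exists>F. module.subspace scaleX F \<and> F \<subseteq> M0 \<and>
    (\<exists>S. linear_homeomorphism_on scaleX scale_seq F N c0 norm S) \<and>
    linear_homeomorphism_on scaleX scaleZ F N (T ` F) norm T"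
proof -
  have Tlin: "linear_on scaleX scaleZ M0 T" using T by (simp add: bounded_linear_on_def)
  obtain K where K: "\<And>x. x \<in> M0 \<Longrightarrow> norm (T x) \<le> K * N x"
    using T unfolding bounded_linear_on_def by blast
  obtain y where y: "\<forall>n. y n \<in> M0" "\<forall>n. norm (y n) \<le> (1/2) ^ n" "\<forall>n. e < norm (T (y n))"
    "\<forall>L\<in>\<L>. \<forall>J. finite J \<longrightarrow> (\<Sum>n\<in>J. norm (blinfun_apply L (y n))) \<le> 3"
    by (rule gliding_hump[OF P])
  have "\<forall>n. \<exists>h. h \<in> dual scaleZ \<and> (\<forall>z. norm (h z) \<le> norm z) \<and> norm (h (T (y n))) = norm (T (y n))"
    using norming_functional[OF scaleZ] by metis
  from choice[OF this] obtain h where h: "\<forall>n. h n \<in> dual scaleZ \<and> (\<forall>z. norm (h n z) \<le> norm z) \<and>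
    norm (h n (T (y n))) = norm (T (y n))" by (rule exE)
  \<comment> \<open>With phases \<open>c\<close> a row sum becomes the value of one functional at
    \<open>T ?x\<close>, and the gliding hump bound 3 controls \<open>N ?x\<close>. This is the
    uniform row bound that disjointification starts from.\<close>
  have rows: "(\<Sum>j\<in>J. norm (h k (T (y j)))) \<le> \<bar>K\<bar> * 3" if J: "finite J" for k J
  proof -
    have "\<forall>j. \<exists>c. norm c = 1 \<and> c * h k (T (y j)) = of_real (norm (h k (T (y j))))"
      using phase_exists by metis
    from choice[OF this] obtain c
      where c: "\<forall>j. norm (c j) = 1 \<and> c j * h k (T (y j)) = of_real (norm (h k (T (y j))))" by (rule exE)
    let ?x = "\<Sum>j\<in>J. scaleX (c j) (y j)"
    have x: "?x \<in> M0" by (rule subspace_combination[OF normed_space_on_M0 _ J]) (use y(1) in blast)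
    have "T ?x = (\<Sum>j\<in>J. scaleZ (c j) (T (y j)))"
      by (rule linear_on_combination[OF normed_space_on_M0 Tlin _ J]) (use y(1) in blast)
    moreover have hk: "h k \<in> dual scaleZ" using h by blast
    ultimately have "h k (T ?x) = (\<Sum>j\<in>J. c j * h k (T (y j)))"
      by (simp only: dual_combination[OF hk J])
    also have "\<dots> = of_real (\<Sum>j\<in>J. norm (h k (T (y j))))" using c by simp
    finally have "(\<Sum>j\<in>J. norm (h k (T (y j)))) = norm (h k (T ?x))"
      by (simp only: norm_of_real) (simp add: sum_nonneg)
    also have "\<dots> \<le> norm (T ?x)" using h by blast
    also have "\<dots> \<le> \<bar>K\<bar> * N ?x"
      using K[OF x] mult_right_mono[of K "\<bar>K\<bar>" "N ?x"] N_nonneg by fastforce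
    also have "N ?x \<le> 1 * 3"
      by (rule M_I(2)) (use c y(1,4) J in \<open>auto intro!: combination_bound[where s = 1, simplified]\<close>)
    then have "\<bar>K\<bar> * N ?x \<le> \<bar>K\<bar> * 3" by (intro mult_left_mono) auto
    finally show ?thesis .
  qed
  obtain r where r: "strict_mono (r :: nat \<Rightarrow> nat)"
    "\<forall>k J. finite J \<longrightarrow> k \<notin> J \<longrightarrow> (\<Sum>j\<in>J. norm (h (r k) (T (y (r j))))) \<le> e / 2"
    by (rule rosenthal_disjointification[of "\<lambda>k j. norm (h k (T (y j)))" "e / 2", OF _ _ rows])
      (use e in auto)
  show ?thesis
  proof (rule c0_copy[OF scaleZ T, of "\<lambda>n. y (r n)" 3 "\<lambda>n. h (r n)" e])
    \<comment> \<open>\<open>r n \<ge> n\<close>, so the geometric decay survives along the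
      subsequence.\<close>
    show "norm (y (r n)) \<le> (1/2) ^ n" for n
      by (rule order_trans[OF y(2)[rule_format] power_decreasing[OF seq_suble[OF r(1)]]]) auto
    show "(\<Sum>n\<in>J. norm (blinfun_apply L (y (r n)))) \<le> 3" if "L \<in> \<L>" "finite J" for L J
    proof -
      have "inj_on r J" using strict_mono_imp_inj_on[OF r(1)] inj_on_subset by blast
      then have "(\<Sum>n\<in>J. norm (blinfun_apply L (y (r n)))) = (\<Sum>n\<in>r ` J. norm (blinfun_apply L (y n)))"
        by (simp add: sum.reindex)
      then show ?thesis using y(4) that by simp
    qed
    show "e \<le> norm (h (r k) (T (y (r k))))" for k using h y(3) by (simp add: less_imp_le)
  qed (use y h e r(2) in auto)
qed

end

theorem corollary1p7:
  fixes scaleX :: "'k::real_or_complex \<Rightarrow> 'x::banach \<Rightarrow> 'x"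
    and scaleY :: "'k \<Rightarrow> 'y::banach \<Rightarrow> 'y"
    and scaleZ :: "'k \<Rightarrow> 'z::banach \<Rightarrow> 'z"
    and \<L> :: "('x \<Rightarrow>\<^sub>L 'y) set"
    and \<tau> :: "('x \<Rightarrow>\<^sub>L 'y) topology"
    and T :: "'x \<Rightarrow> 'z"
  assumes "banach_space scaleX" and "banach_space scaleY" and "banach_space scaleZ"
    and "separable_space (euclidean :: 'x topology)"
    and "reflexive scaleX"
    and "\<forall>L\<in>\<L>. Vector_Spaces.linear scaleX scaleY (blinfun_apply L)"
    and "topspace \<tau> = \<L>"
    and "Hausdorff_space \<tau>" and "sigma_compact_space \<tau>" and "locally_compact_space \<tau>"
    and "\<forall>x. continuous_map \<tau> euclidean (\<lambda>L. blinfun_apply L x)"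
    and "closure (M_space \<L>) = UNIV"
    and "banach_space_on scaleX (M_space \<L>) (M_norm \<L>)"
    and "\<exists>C. \<forall>x\<in>M_space \<L>. norm x \<le> C * M_norm \<L> x"
    and "assumption_A scaleX \<L> \<tau>"
    and "bounded_linear_on scaleX scaleZ (M0_space \<L> \<tau>) (M_norm \<L>) T"
  shows "weakly_compact_on scaleZ (M0_space \<L> \<tau>) (M_norm \<L>) T \<longleftrightarrow>
    \<not> (\<exists>F. module.subspace scaleX F \<and> F \<subseteq> M0_space \<L> \<tau> \<and>
          (\<exists>S. linear_homeomorphism_on scaleX scale_seq F (M_norm \<L>) c0 norm S) \<and>
          linear_homeomorphism_on scaleX scaleZ F (M_norm \<L>) (T ` F) norm T)"
    (is "?wc \<longleftrightarrow> \<not> ?fixes_c0")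
proof -
  obtain C0 where C0: "\<forall>x\<in>M_space \<L>. norm x \<le> C0 * M_norm \<L> x" using assms(14) by blast
  define C where "C = \<bar>C0\<bar> + 1"
  have C: "0 < C" "norm x \<le> C * M_norm \<L> x" if "x \<in> M_space \<L>" for x
  proof -
    have "C0 * M_norm \<L> x \<le> C * M_norm \<L> x"
      by (intro mult_right_mono) (auto simp: C_def M_norm_def)
    then show "norm x \<le> C * M_norm \<L> x" using C0 that by force
  qed (simp add: C_def)
  have lin: "blinfun_apply L (scaleX c x) = scaleY c (blinfun_apply L x)" if "L \<in> \<L>" for L c x
    using assms(6) that by (simp add: Vector_Spaces.linear_iff)
  interpret operator_family scaleX scaleY \<L> \<tau> C
    by (unfold_locales) (use assms C lin in \<open>auto simp: C_def\<close>)
  show ?thesis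
  proof
    assume wc: ?wc
    show "\<not> ?fixes_c0"
      using not_weakly_compact_on_if_fixes_c0[OF assms(3) normed_space_on_M0 wc] by blast
  next
    assume no_c0: "\<not> ?fixes_c0"
    show ?wc
    proof (rule weakly_compact_on_if_continuous_on_ball[OF assms(1,3,5) normed_space_on_M0, of C])
      show "0 < C" by (simp add: C_def)
      show "norm x \<le> C * N x" if "x \<in> M0" for x using C(2) that M0_subset_M by blast
      fix e :: real assume e: "0 < e"
      show "\<exists>d>0. \<forall>y\<in>M0. N y \<le> 1 \<longrightarrow> norm y < d \<longrightarrow> norm (T y) \<le> e"
      \<comment> \<open>Failure for one \<open>e\<close> supplies, for every \<open>d\<close>, a
        vector of the ball with norm below \<open>d\<close> in \<open>X\<close> and image above
        \<open>e\<close>: the input of the gliding hump.\<close>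
      proof (rule ccontr)
        assume "\<not> ?thesis"
        then have "\<exists>y\<in>M0. N y \<le> 1 \<and> norm y < d \<and> e < norm (T y)" if "0 < d" for d
          using that by (meson not_le)
        from fixes_c0_if_discontinuous_on_ball[OF assms(3,16) e this] no_c0 show False by blast
      qed
    qed (rule assms(16))
  qed
qed

end
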